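(* Let $A\in\mathcal{V}$ and $\theta\in Con(A)$. Then $\theta$ has $CBLP$ if and only if $\rho(\theta)$ has $CBLP$.
   Context: $\mathcal{V}$ is a congruence modular, semidegenerate variety (no nontrivial algebra has a one-element subalgebra; equivalently $\nabla_B$ is compact for all $B\in\mathcal{V}$) of finite signature. For $B\in\mathcal{V}$: $Con(B)$ is its congruence lattice with bounds $\Delta_B,\nabla_B$, $[\cdot,\cdot]$ the Freese–McKenzie commutator, $K(B)$ the compact congruences. A congruence $\phi\neq\nabla_B$ is prime if $[\alpha,\beta]\subseteq\phi$ implies $\alpha\subseteq\phi$ or $\beta\subseteq\phi$; $\rho(\theta)$ is the intersection of all prime congruences containing $\theta$. $B(Con(B))$ is the Boolean algebra of complemented elements of $Con(B)$. When $K(B)$ is closed under the commutator, the reticulation $L(B)=K(B)/{\equiv}$ ($\alpha\equiv\beta$ iff $\rho(\alpha)=\rho(\beta)$) is a bounded distributive lattice with canonical map $\lambda_B$, which maps $B(Con(B))$ injectively into the Boolean center $B(L(B))$; the reticulation of $B$ preserves the Boolean center if this map $B(Con(B))\to B(L(B))$ is surjective. Standing assumption: for every $B\in\mathcal{V}$, $K(B)$ is closed under the commutator and the reticulation of $B$ preserves the Boolean center. For $\theta\in Con(A)$, congruences of $A/\theta$ are exactly $\chi/\theta$ with $\chi\supseteq\theta$. The congruence $\theta$ has the Congruence Boolean Lifting Property ($CBLP$) if for every $\beta\in B(Con(A/\theta))$ there exists $\alpha\in B(Con(A))$ with $(\alpha\vee\theta)/\theta=\beta$. *)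

theory Defs
  imports Main
begin

text \<open>A signature is given by a type of operation symbols 'f together with an
arity function ar. An algebra is a (nonempty) carrier set with an interpretation
of every operation symbol on lists of arguments (only lists of the right length
matter).\<close>

record ('a, 'f) alg =
  carrier :: "'a set"
  ops :: "'f \<Rightarrow> 'a list \<Rightarrow> 'a"

definition algebra :: "('f \<Rightarrow> nat) \<Rightarrow> ('a, 'f) alg \<Rightarrow> bool" where
  "algebra ar B \<longleftrightarrow> carrier B \<noteq> {} \<and>
     (\<forall>f xs. length xs = ar f \<and> set xs \<subseteq> carrier B \<longrightarrow> ops B f xs \<in> carrier B)"

datatype ('f, 'v) "term" = Var 'v | App 'f "('f, 'v) term list"

fun wf_term :: "('f \<Rightarrow> nat) \<Rightarrow> ('f, 'v) term \<Rightarrow> bool" where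
  "wf_term ar (Var x) = True"
| "wf_term ar (App f ts) = (length ts = ar f \<and> (\<forall>t\<in>set ts. wf_term ar t))"

fun eval :: "('a, 'f) alg \<Rightarrow> ('v \<Rightarrow> 'a) \<Rightarrow> ('f, 'v) term \<Rightarrow> 'a" where
  "eval B v (Var x) = v x"
| "eval B v (App f ts) = ops B f (map (eval B v) ts)"

text \<open>The variety V is the equational class Mod(Eqs) of a set of (well-formed) identities.\<close>

definition inV :: "('f \<Rightarrow> nat) \<Rightarrow> (('f, nat) term \<times> ('f, nat) term) set \<Rightarrow> ('a, 'f) alg \<Rightarrow> bool" where
  "inV ar Eqs B \<longleftrightarrow> algebra ar B \<and>
     (\<forall>(s, t)\<in>Eqs. \<forall>v. range v \<subseteq> carrier B \<longrightarrow> eval B v s = eval B v t)"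

definition Con :: "('f \<Rightarrow> nat) \<Rightarrow> ('a, 'f) alg \<Rightarrow> ('a \<times> 'a) set set" where
  "Con ar B = {\<theta>. equiv (carrier B) \<theta> \<and>
     (\<forall>f xs ys. length xs = ar f \<and> length ys = ar f \<and> list_all2 (\<lambda>x y. (x, y) \<in> \<theta>) xs ys
        \<longrightarrow> (ops B f xs, ops B f ys) \<in> \<theta>)}"

definition Delta :: "('a, 'f) alg \<Rightarrow> ('a \<times> 'a) set" where
  "Delta B = Id_on (carrier B)"

definition Nabla :: "('a, 'f) alg \<Rightarrow> ('a \<times> 'a) set" where
  "Nabla B = carrier B \<times> carrier B"

definition Cg :: "('f \<Rightarrow> nat) \<Rightarrow> ('a, 'f) alg \<Rightarrow> ('a \<times> 'a) set \<Rightarrow> ('a \<times> 'a) set" where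
  "Cg ar B R = Nabla B \<inter> \<Inter>{\<theta> \<in> Con ar B. R \<subseteq> \<theta>}"

definition Join :: "('f \<Rightarrow> nat) \<Rightarrow> ('a, 'f) alg \<Rightarrow> ('a \<times> 'a) set set \<Rightarrow> ('a \<times> 'a) set" where
  "Join ar B S = Cg ar B (\<Union>S)"

definition join :: "('f \<Rightarrow> nat) \<Rightarrow> ('a, 'f) alg \<Rightarrow> ('a \<times> 'a) set \<Rightarrow> ('a \<times> 'a) set \<Rightarrow> ('a \<times> 'a) set" where
  "join ar B \<alpha> \<beta> = Join ar B {\<alpha>, \<beta>}"

definition modular_Con :: "('f \<Rightarrow> nat) \<Rightarrow> ('a, 'f) alg \<Rightarrow> bool" where
  "modular_Con ar B \<longleftrightarrow> (\<forall>\<alpha>\<in>Con ar B. \<forall>\<beta>\<in>Con ar B. \<forall>\<gamma>\<in>Con ar B.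
      \<alpha> \<subseteq> \<gamma> \<longrightarrow> join ar B \<alpha> (\<beta> \<inter> \<gamma>) = join ar B \<alpha> \<beta> \<inter> \<gamma>)"

definition K :: "('f \<Rightarrow> nat) \<Rightarrow> ('a, 'f) alg \<Rightarrow> ('a \<times> 'a) set set" where
  "K ar B = {\<alpha> \<in> Con ar B. \<forall>S. S \<subseteq> Con ar B \<and> \<alpha> \<subseteq> Join ar B S
      \<longrightarrow> (\<exists>T \<subseteq> S. finite T \<and> \<alpha> \<subseteq> Join ar B T)}"

definition BoolCon :: "('f \<Rightarrow> nat) \<Rightarrow> ('a, 'f) alg \<Rightarrow> ('a \<times> 'a) set set" where
  "BoolCon ar B = {\<alpha> \<in> Con ar B. \<exists>\<beta>\<in>Con ar B. \<alpha> \<inter> \<beta> = Delta B \<and> join ar B \<alpha> \<beta> = Nabla B}"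

text \<open>Term condition: alpha centralizes beta modulo delta. Term variables Inl i are the
alpha-variables, Inr j the beta-variables.\<close>

definition centralizes :: "('f \<Rightarrow> nat) \<Rightarrow> ('a, 'f) alg \<Rightarrow> ('a \<times> 'a) set \<Rightarrow> ('a \<times> 'a) set
    \<Rightarrow> ('a \<times> 'a) set \<Rightarrow> bool" where
  "centralizes ar B \<alpha> \<beta> \<delta> \<longleftrightarrow>
     (\<forall>(t :: ('f, nat + nat) term) a b c d. wf_term ar t \<longrightarrow>
        (\<forall>i. (a i, b i) \<in> \<alpha>) \<longrightarrow> (\<forall>j. (c j, d j) \<in> \<beta>) \<longrightarrow>
        (eval B (case_sum a c) t, eval B (case_sum a d) t) \<in> \<delta> \<longrightarrow>
        (eval B (case_sum b c) t, eval B (case_sum b d) t) \<in> \<delta>)"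

definition comm :: "('f \<Rightarrow> nat) \<Rightarrow> ('a, 'f) alg \<Rightarrow> ('a \<times> 'a) set \<Rightarrow> ('a \<times> 'a) set \<Rightarrow> ('a \<times> 'a) set" where
  "comm ar B \<alpha> \<beta> = Nabla B \<inter> \<Inter>{\<delta> \<in> Con ar B. centralizes ar B \<alpha> \<beta> \<delta>}"

definition prime_con :: "('f \<Rightarrow> nat) \<Rightarrow> ('a, 'f) alg \<Rightarrow> ('a \<times> 'a) set \<Rightarrow> bool" where
  "prime_con ar B \<phi> \<longleftrightarrow> \<phi> \<in> Con ar B \<and> \<phi> \<noteq> Nabla B \<and>
     (\<forall>\<alpha>\<in>Con ar B. \<forall>\<beta>\<in>Con ar B. comm ar B \<alpha> \<beta> \<subseteq> \<phi> \<longrightarrow> \<alpha> \<subseteq> \<phi> \<or> \<beta> \<subseteq> \<phi>)"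

text \<open>rho(theta): intersection of all prime congruences containing theta (empty intersection = Nabla).\<close>

definition rho :: "('f \<Rightarrow> nat) \<Rightarrow> ('a, 'f) alg \<Rightarrow> ('a \<times> 'a) set \<Rightarrow> ('a \<times> 'a) set" where
  "rho ar B \<theta> = Nabla B \<inter> \<Inter>{\<phi>. prime_con ar B \<phi> \<and> \<theta> \<subseteq> \<phi>}"

definition K_comm_closed :: "('f \<Rightarrow> nat) \<Rightarrow> ('a, 'f) alg \<Rightarrow> bool" where
  "K_comm_closed ar B \<longleftrightarrow> (\<forall>\<alpha>\<in>K ar B. \<forall>\<beta>\<in>K ar B. comm ar B \<alpha> \<beta> \<in> K ar B)"

text \<open>The reticulation L(B) = K(B)/\<equiv>, where alpha \<equiv> beta iff rho(alpha) = rho(beta), with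
lambda_B(alpha) the class of alpha, lattice operations lambda(alpha) \<and> lambda(beta) = lambda([alpha,beta]),
lambda(alpha) \<or> lambda(beta) = lambda(alpha \<or> beta), bottom lambda(Delta), top lambda(Nabla).
The class lambda(alpha) is in the Boolean center B(L(B)) iff it has a complement in L(B);
the reticulation preserves the Boolean center iff every element of B(L(B)) is lambda(gamma)
for some gamma in B(Con(B)). Both are written out on representatives.\<close>

definition ret_bool :: "('f \<Rightarrow> nat) \<Rightarrow> ('a, 'f) alg \<Rightarrow> ('a \<times> 'a) set \<Rightarrow> bool" where
  "ret_bool ar B \<alpha> \<longleftrightarrow> \<alpha> \<in> K ar B \<and>
     (\<exists>\<beta>\<in>K ar B. rho ar B (comm ar B \<alpha> \<beta>) = rho ar B (Delta B)
                \<and> rho ar B (join ar B \<alpha> \<beta>) = rho ar B (Nabla B))"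

definition ret_preserves_bool :: "('f \<Rightarrow> nat) \<Rightarrow> ('a, 'f) alg \<Rightarrow> bool" where
  "ret_preserves_bool ar B \<longleftrightarrow>
     (\<forall>\<alpha>. ret_bool ar B \<alpha> \<longrightarrow> (\<exists>\<gamma>\<in>BoolCon ar B. rho ar B \<gamma> = rho ar B \<alpha>))"

definition no_trivial_subalg :: "('f \<Rightarrow> nat) \<Rightarrow> ('a, 'f) alg \<Rightarrow> bool" where
  "no_trivial_subalg ar B \<longleftrightarrow>
     ((\<exists>x\<in>carrier B. \<exists>y\<in>carrier B. x \<noteq> y) \<longrightarrow>
        \<not> (\<exists>x\<in>carrier B. \<forall>f. ops B f (replicate (ar f) x) = x))"

definition standing :: "('f \<Rightarrow> nat) \<Rightarrow> (('f, nat) term \<times> ('f, nat) term) set \<Rightarrow> ('a, 'f) alg \<Rightarrow> bool" where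
  "standing ar Eqs B \<longleftrightarrow> (inV ar Eqs B \<longrightarrow>
     modular_Con ar B \<and> no_trivial_subalg ar B \<and> K_comm_closed ar B \<and> ret_preserves_bool ar B)"

definition quot :: "('a, 'f) alg \<Rightarrow> ('a \<times> 'a) set \<Rightarrow> ('a set, 'f) alg" where
  "quot B \<theta> = \<lparr>carrier = carrier B // \<theta>,
               ops = (\<lambda>f Xs. \<theta> `` {ops B f (map (\<lambda>X. SOME x. x \<in> X) Xs)})\<rparr>"

definition quot_con :: "('a \<times> 'a) set \<Rightarrow> ('a \<times> 'a) set \<Rightarrow> ('a set \<times> 'a set) set" where
  "quot_con \<theta> \<chi> = {(\<theta> `` {x}, \<theta> `` {y}) | x y. (x, y) \<in> \<chi>}"

definition CBLP :: "('f \<Rightarrow> nat) \<Rightarrow> ('a, 'f) alg \<Rightarrow> ('a \<times> 'a) set \<Rightarrow> bool" where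
  "CBLP ar A \<theta> \<longleftrightarrow> (\<forall>\<beta>\<in>BoolCon ar (quot A \<theta>).
      \<exists>\<alpha>\<in>BoolCon ar A. quot_con \<theta> (join ar A \<alpha> \<theta>) = \<beta>)"

end

theory Submission
  imports Defs "HOL-Library.Nat_Bijection"
begin

text \<open>
Write \<open>C(\<alpha>, \<beta>; \<delta>)\<close> for the term condition and \<open>A(\<beta>)\<close> for \<open>\<beta>\<close> as a subalgebra of \<open>A \<times> A\<close>.
The term condition says that \<open>\<delta>\<close> is saturated under the congruence of \<open>A(\<beta>)\<close> generated by the pairs
\<open>((x, x), (y, y))\<close> with \<open>(x, y) \<in> \<alpha>\<close>. Gumm's shifting lemma in \<open>A(\<beta>)\<close> then shows that
\<open>C(\<alpha>, \<beta>; \<delta>)\<close> persists for larger \<open>\<delta>\<close> and is symmetric in \<open>\<alpha>, \<beta>\<close>. For \<open>\<alpha> = \<nabla>\<close> the quotient of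
\<open>A(\<beta>)\<close> by that congruence has a one-element subalgebra, the class of the diagonal, so by
semidegeneracy \<open>C(\<nabla>, \<beta>; \<delta>)\<close> forces \<open>\<beta> \<subseteq> \<delta>\<close>. It follows that proper congruences lie below primes,
that primes of \<open>A/\<theta>\<close> correspond to primes of \<open>A\<close> above \<open>\<theta>\<close>, and that congruences complemented
over \<open>\<theta>\<close> are determined by the primes containing them. Since \<open>\<theta>\<close> and \<open>\<rho>(\<theta>)\<close> lie below the same
primes, \<open>\<chi> \<mapsto> \<chi> \<or> \<rho>(\<theta>)\<close> embeds the complemented congruences over \<open>\<theta>\<close> into those over \<open>\<rho>(\<theta>)\<close>;
it is onto because the reticulation of \<open>A/\<theta>\<close> preserves the Boolean center.

The hypotheses only speak about algebras on the types \<open>'a\<close> and \<open>'a set\<close>, so the auxiliary algebras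
have to be re-coded there. This works for every proper subset of \<open>A \<times> A\<close>, but not for \<open>A \<times> A\<close> itself
if \<open>A\<close> has three elements, whence the case \<open>\<beta> = \<nabla>\<close> is always treated separately.
\<close>

section \<open>Congruences\<close>

lemma Con_subset: "\<theta> \<in> Con ar B \<Longrightarrow> \<theta> \<subseteq> Nabla B"
  by (simp add: Con_def equiv_def Nabla_def)

lemma Con_carrier:
  assumes "\<theta> \<in> Con ar B" and "(x, y) \<in> \<theta>"
  shows "x \<in> carrier B" and "y \<in> carrier B"
  using Con_subset[OF assms(1)] assms(2) by (auto simp: Nabla_def)

lemma Con_refl: "\<theta> \<in> Con ar B \<Longrightarrow> x \<in> carrier B \<Longrightarrow> (x, x) \<in> \<theta>"
  by (simp add: Con_def equiv_def refl_on_def)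

lemma Con_sym: "\<theta> \<in> Con ar B \<Longrightarrow> (x, y) \<in> \<theta> \<Longrightarrow> (y, x) \<in> \<theta>"
  by (auto simp: Con_def equiv_def dest: symD)

lemma Con_trans: "\<theta> \<in> Con ar B \<Longrightarrow> (x, y) \<in> \<theta> \<Longrightarrow> (y, z) \<in> \<theta> \<Longrightarrow> (x, z) \<in> \<theta>"
  by (auto simp: Con_def equiv_def dest: transD)

lemma Con_ops:
  "\<theta> \<in> Con ar B \<Longrightarrow> length xs = ar f \<Longrightarrow> list_all2 (\<lambda>x y. (x, y) \<in> \<theta>) xs ys
    \<Longrightarrow> (ops B f xs, ops B f ys) \<in> \<theta>"
  using list_all2_lengthD[of "\<lambda>x y. (x, y) \<in> \<theta>" xs ys] by (simp add: Con_def)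

lemma ConI:
  assumes "\<theta> \<subseteq> Nabla B"
    and "\<And>x. x \<in> carrier B \<Longrightarrow> (x, x) \<in> \<theta>"
    and "\<And>x y. (x, y) \<in> \<theta> \<Longrightarrow> (y, x) \<in> \<theta>"
    and "\<And>x y z. (x, y) \<in> \<theta> \<Longrightarrow> (y, z) \<in> \<theta> \<Longrightarrow> (x, z) \<in> \<theta>"
    and "\<And>f xs ys. length xs = ar f \<Longrightarrow> list_all2 (\<lambda>x y. (x, y) \<in> \<theta>) xs ys
           \<Longrightarrow> (ops B f xs, ops B f ys) \<in> \<theta>"
  shows "\<theta> \<in> Con ar B"
  using assms unfolding Con_def equiv_def refl_on_def sym_def trans_def Nabla_def by blast

lemma list_all2_subset:
  "list_all2 (\<lambda>x y. (x, y) \<in> \<theta>) xs ys \<Longrightarrow> \<theta> \<subseteq> \<phi> \<Longrightarrow> list_all2 (\<lambda>x y. (x, y) \<in> \<phi>) xs ys"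
  by (auto elim: list_all2_mono)

lemma list_all2_NablaD:
  "list_all2 (\<lambda>x y. (x, y) \<in> \<theta>) xs ys \<Longrightarrow> \<theta> \<subseteq> Nabla B
    \<Longrightarrow> set xs \<subseteq> carrier B \<and> set ys \<subseteq> carrier B"
  by (induction rule: list_all2_induct) (auto simp: Nabla_def)

lemma algebra_ops:
  "algebra ar B \<Longrightarrow> length xs = ar f \<Longrightarrow> set xs \<subseteq> carrier B \<Longrightarrow> ops B f xs \<in> carrier B"
  by (simp add: algebra_def)

lemma Con_Nabla: "algebra ar B \<Longrightarrow> Nabla B \<in> Con ar B"
proof (rule ConI)
  fix f xs ys
  assume B: "algebra ar B" and len: "length xs = ar f"
    and l: "list_all2 (\<lambda>x y. (x, y) \<in> Nabla B) xs ys"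
  then show "(ops B f xs, ops B f ys) \<in> Nabla B"
    using list_all2_NablaD[OF l order_refl] list_all2_lengthD[OF l] algebra_ops[OF B]
    by (auto simp: Nabla_def)
qed (auto simp: Nabla_def)

lemma Con_Delta:
  assumes "algebra ar B"
  shows "Delta B \<in> Con ar B"
proof (rule ConI)
  show "(ops B f xs, ops B f ys) \<in> Delta B"
    if "length xs = ar f" "list_all2 (\<lambda>x y. (x, y) \<in> Delta B) xs ys" for f xs ys
  proof -
    have "xs = ys \<and> set xs \<subseteq> carrier B"
      using that(2) by (induction rule: list_all2_induct) (auto simp: Delta_def)
    then show ?thesis using algebra_ops[OF assms that(1)] by (auto simp: Delta_def)
  qed
qed (auto simp: Delta_def Nabla_def)

lemma Delta_subset: "\<theta> \<in> Con ar B \<Longrightarrow> Delta B \<subseteq> \<theta>"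
  by (auto simp: Delta_def intro: Con_refl)

lemma Con_Nabla_Inter:
  assumes "algebra ar B" and "S \<subseteq> Con ar B"
  shows "Nabla B \<inter> \<Inter>S \<in> Con ar B"
proof -
  let ?N = "Nabla B \<inter> \<Inter>S"
  note N = Con_Nabla[OF assms(1)]
  show ?thesis
  proof (rule ConI)
    show "(x, x) \<in> ?N" if "x \<in> carrier B" for x
      using that assms(2) Con_refl[OF N] Con_refl by fastforce
    show "(y, x) \<in> ?N" if "(x, y) \<in> ?N" for x y
      using that assms(2) Con_sym[OF N] Con_sym by fastforce
    show "(x, z) \<in> ?N" if "(x, y) \<in> ?N" "(y, z) \<in> ?N" for x y z
      using that assms(2) Con_trans[OF N, of x y z] Con_trans[of _ ar B x y z] by blast
    show "(ops B f xs, ops B f ys) \<in> ?N"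
      if len: "length xs = ar f" and l: "list_all2 (\<lambda>x y. (x, y) \<in> ?N) xs ys" for f xs ys
    proof -
      have "(ops B f xs, ops B f ys) \<in> \<phi>" if "\<phi> = Nabla B \<or> \<phi> \<in> S" for \<phi>
        using that N assms(2) list_all2_subset[OF l, of \<phi>] len
        by (intro Con_ops[of \<phi> ar]) auto
      then show ?thesis by blast
    qed
  qed auto
qed

lemma Con_Int:
  assumes "algebra ar B" "\<alpha> \<in> Con ar B" "\<beta> \<in> Con ar B"
  shows "\<alpha> \<inter> \<beta> \<in> Con ar B"
  using Con_Nabla_Inter[OF assms(1), of "{\<alpha>, \<beta>}"] assms Con_subset[OF assms(2)]
  by (simp add: inf.absorb2 le_infI1)

lemma Cg_Con: "algebra ar B \<Longrightarrow> Cg ar B R \<in> Con ar B"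
  unfolding Cg_def by (rule Con_Nabla_Inter) auto

lemma Cg_upper: "R \<subseteq> Nabla B \<Longrightarrow> R \<subseteq> Cg ar B R"
  unfolding Cg_def by auto

lemma Cg_least: "\<theta> \<in> Con ar B \<Longrightarrow> R \<subseteq> \<theta> \<Longrightarrow> Cg ar B R \<subseteq> \<theta>"
  unfolding Cg_def by auto

lemma join_Con: "algebra ar B \<Longrightarrow> join ar B \<alpha> \<beta> \<in> Con ar B"
  by (simp add: join_def Join_def Cg_Con)

lemma join_upper1: "\<alpha> \<in> Con ar B \<Longrightarrow> \<beta> \<in> Con ar B \<Longrightarrow> \<alpha> \<subseteq> join ar B \<alpha> \<beta>"
  and join_upper2: "\<alpha> \<in> Con ar B \<Longrightarrow> \<beta> \<in> Con ar B \<Longrightarrow> \<beta> \<subseteq> join ar B \<alpha> \<beta>"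
  using Cg_upper[of "\<alpha> \<union> \<beta>" B ar] Con_subset[of \<alpha> ar B] Con_subset[of \<beta> ar B]
  by (auto simp: join_def Join_def)

lemma join_least:
  "\<gamma> \<in> Con ar B \<Longrightarrow> \<alpha> \<subseteq> \<gamma> \<Longrightarrow> \<beta> \<subseteq> \<gamma> \<Longrightarrow> join ar B \<alpha> \<beta> \<subseteq> \<gamma>"
  by (simp add: join_def Join_def Cg_least)

text \<open>Transitivity and compatibility each involve only finitely many pairs, and directedness
  collects these in one member of \<open>S\<close>. This serves both the compactness of finitely
  generated congruences and the chains of Zorn's lemma.\<close>

lemma Con_directed_Union:
  assumes "algebra ar B" and S: "S \<subseteq> Con ar B" "S \<noteq> {}"
    and dir: "\<And>X Y. X \<in> S \<Longrightarrow> Y \<in> S \<Longrightarrow> \<exists>Z\<in>S. X \<union> Y \<subseteq> Z"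
  shows "\<Union>S \<in> Con ar B"
proof (rule ConI)
  show "\<Union>S \<subseteq> Nabla B" using S Con_subset by blast
  show "(x, x) \<in> \<Union>S" if "x \<in> carrier B" for x
    using S that Con_refl by (metis UnionI ex_in_conv subsetD)
  show "(y, x) \<in> \<Union>S" if "(x, y) \<in> \<Union>S" for x y
    using S that Con_sym by (meson UnionE UnionI subsetD)
  show "(x, z) \<in> \<Union>S" if xy: "(x, y) \<in> \<Union>S" and yz: "(y, z) \<in> \<Union>S" for x y z
  proof -
    obtain X Y where "X \<in> S" "(x, y) \<in> X" "Y \<in> S" "(y, z) \<in> Y" using xy yz by blast
    then obtain Z where Z: "Z \<in> S" "(x, y) \<in> Z" "(y, z) \<in> Z" using dir[of X Y] by blast
    then show ?thesis using S Con_trans[of Z ar B x y z] by blast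
  qed
  show "(ops B f xs, ops B f ys) \<in> \<Union>S"
    if len: "length xs = ar f" and l: "list_all2 (\<lambda>x y. (x, y) \<in> \<Union>S) xs ys" for f xs ys
  proof -
    from l have "\<exists>Z\<in>S. list_all2 (\<lambda>x y. (x, y) \<in> Z) xs ys"
    proof (induction rule: list_all2_induct)
      case Nil
      then show ?case using S by auto
    next
      case (Cons x xs y ys)
      then obtain X Y where "X \<in> S" "(x, y) \<in> X" "Y \<in> S" and Y: "list_all2 (\<lambda>x y. (x, y) \<in> Y) xs ys"
        by blast
      then obtain Z where Z: "Z \<in> S" "X \<union> Y \<subseteq> Z" using dir[of X Y] by blast
      moreover have "list_all2 (\<lambda>x y. (x, y) \<in> Z) xs ys" using list_all2_subset[OF Y] Z by blast
      ultimately show ?case using \<open>(x, y) \<in> X\<close> by auto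
    qed
    then obtain Z where "Z \<in> S" "list_all2 (\<lambda>x y. (x, y) \<in> Z) xs ys" by blast
    then show ?thesis using S len Con_ops[of Z ar B xs f ys] by blast
  qed
qed

text \<open>Corresponding arguments may be linked by chains of different lengths. They are therefore
  moved one position and one link at a time, with reflexivity of \<open>R\<close> at all other
  positions.\<close>

lemma Con_trancl:
  assumes B: "algebra ar B" and R: "R \<subseteq> Nabla B"
    and refl: "\<And>x. x \<in> carrier B \<Longrightarrow> (x, x) \<in> R"
    and sym: "\<And>x y. (x, y) \<in> R \<Longrightarrow> (y, x) \<in> R"
    and comp: "\<And>f xs ys. length xs = ar f \<Longrightarrow> list_all2 (\<lambda>x y. (x, y) \<in> R) xs ys
           \<Longrightarrow> (ops B f xs, ops B f ys) \<in> R"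
  shows "R\<^sup>+ \<in> Con ar B"
proof (rule ConI)
  show sub: "R\<^sup>+ \<subseteq> Nabla B" using R unfolding Nabla_def by (rule trancl_subset_Sigma)
  show "(x, x) \<in> R\<^sup>+" if "x \<in> carrier B" for x using refl[OF that] by blast
  have "Relation.sym R" using sym by (auto simp: sym_def)
  then show "(y, x) \<in> R\<^sup>+" if "(x, y) \<in> R\<^sup>+" for x y
    using that sym_trancl by (auto dest: symD)
  show "(x, z) \<in> R\<^sup>+" if "(x, y) \<in> R\<^sup>+" "(y, z) \<in> R\<^sup>+" for x y z
    using that by simp
  show "(ops B f xs, ops B f ys) \<in> R\<^sup>+"
    if len: "length xs = ar f" and l: "list_all2 (\<lambda>x y. (x, y) \<in> R\<^sup>+) xs ys" for f xs ys
  proof -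
    have refl_list: "list_all2 (\<lambda>x y. (x, y) \<in> R) zs zs" if "set zs \<subseteq> carrier B" for zs
      using that refl by (intro list_all2_refl[THEN list_all2_mono] list.rel_refl_strong) auto
    \<comment> \<open>The prefix \<open>us\<close> holds the arguments that have already reached
      their final values.\<close>
    from l have "(ops B f (us @ xs), ops B f (us @ ys)) \<in> R\<^sup>+"
      if "set us \<subseteq> carrier B" "length us + length xs = ar f" for us
      using that
    proof (induction arbitrary: us rule: list_all2_induct)
      case Nil
      then show ?case using refl algebra_ops[OF B] by auto
    next
      case (Cons x xs y ys)
      from Cons(2) have xs: "set xs \<subseteq> carrier B"
        using list_all2_NablaD sub by blast
      from Cons(1) have "(ops B f (us @ x # xs), ops B f (us @ y # xs)) \<in> R\<^sup>+"
      proof (induction rule: trancl_induct)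
        case (base y)
        then show ?case using Cons.prems
          by (intro r_into_trancl comp list_all2_appendI) (auto simp: refl_list xs)
      next
        case (step y z)
        then have "(ops B f (us @ y # xs), ops B f (us @ z # xs)) \<in> R" using Cons.prems
          by (intro comp list_all2_appendI) (auto simp: refl_list xs)
        with step show ?case by simp
      qed
      moreover have "y \<in> carrier B" using Cons(1) sub by (auto simp: Nabla_def)
      then have "(ops B f ((us @ [y]) @ xs), ops B f ((us @ [y]) @ ys)) \<in> R\<^sup>+"
        using Cons.prems by (intro Cons.IH) auto
      ultimately show ?case by simp
    qed
    from this[of "[]"] show ?thesis using len by simp
  qed
qed

text \<open>The palindrome \<open>\<alpha> O \<beta> O \<alpha>\<close> is reflexive, symmetric and
  compatible, so its transitive closure is a congruence above \<alpha> and \<beta>, hence above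
  their join. Thus \<open>P\<close> only has to be carried along finite chains of \<alpha>- and
  \<beta>-steps.\<close>

lemma join_induct:
  assumes B: "algebra ar B" and \<alpha>: "\<alpha> \<in> Con ar B" and \<beta>: "\<beta> \<in> Con ar B"
    and xy: "(x, y) \<in> join ar B \<alpha> \<beta>"
    and "P x"
    and step: "\<And>u v. P u \<Longrightarrow> (u, v) \<in> \<alpha> \<or> (u, v) \<in> \<beta> \<Longrightarrow> P v"
  shows "P y"
proof -
  let ?R = "\<alpha> O \<beta> O \<alpha>"
  have "?R\<^sup>+ \<in> Con ar B"
  proof (rule Con_trancl[OF B])
    show "?R \<subseteq> Nabla B" using Con_subset[OF \<alpha>] by (auto simp: Nabla_def)
    show "(x, x) \<in> ?R" if "x \<in> carrier B" for x
      using Con_refl[OF \<alpha> that] Con_refl[OF \<beta> that] by blast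
    show "(y, x) \<in> ?R" if "(x, y) \<in> ?R" for x y
      using that Con_sym[OF \<alpha>] Con_sym[OF \<beta>] by blast
    fix f xs ys
    assume len: "length xs = ar f" and l: "list_all2 (\<lambda>x y. (x, y) \<in> ?R) xs ys"
    from l have "\<exists>us vs. list_all2 (\<lambda>x y. (x, y) \<in> \<alpha>) xs us \<and> list_all2 (\<lambda>x y. (x, y) \<in> \<beta>) us vs
        \<and> list_all2 (\<lambda>x y. (x, y) \<in> \<alpha>) vs ys"
    proof (induction rule: list_all2_induct)
      case (Cons x xs y ys)
      then obtain us vs where *: "list_all2 (\<lambda>x y. (x, y) \<in> \<alpha>) xs us"
        "list_all2 (\<lambda>x y. (x, y) \<in> \<beta>) us vs" "list_all2 (\<lambda>x y. (x, y) \<in> \<alpha>) vs ys" by blast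
      obtain u v where "(x, u) \<in> \<alpha>" "(u, v) \<in> \<beta>" "(v, y) \<in> \<alpha>" using Cons(1) by blast
      with * show ?case by (intro exI[of _ "u # us"] exI[of _ "v # vs"]) simp
    qed auto
    then obtain us vs where *: "list_all2 (\<lambda>x y. (x, y) \<in> \<alpha>) xs us"
      "list_all2 (\<lambda>x y. (x, y) \<in> \<beta>) us vs" "list_all2 (\<lambda>x y. (x, y) \<in> \<alpha>) vs ys" by blast
    then have "length us = ar f" "length vs = ar f"
      using len *[THEN list_all2_lengthD] by simp_all
    with * len show "(ops B f xs, ops B f ys) \<in> ?R"
      using Con_ops[OF \<alpha>] Con_ops[OF \<beta>] by blast
  qed
  moreover have "\<alpha> \<subseteq> ?R\<^sup>+" "\<beta> \<subseteq> ?R\<^sup>+"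
    using Con_refl[OF \<alpha>] Con_refl[OF \<beta>] Con_carrier[OF \<alpha>] Con_carrier[OF \<beta>]
    by (meson r_into_trancl relcomp.relcompI subrelI)+
  ultimately have "join ar B \<alpha> \<beta> \<subseteq> ?R\<^sup>+" by (rule join_least)
  with xy have "(x, y) \<in> ?R\<^sup>+" by blast
  then show ?thesis
  proof (induction rule: trancl_induct)
    case (base y)
    then obtain u v where "(x, u) \<in> \<alpha>" "(u, v) \<in> \<beta>" "(v, y) \<in> \<alpha>" by blast
    with step[OF \<open>P x\<close>, of u] step[of u v] step[of v y] show ?case by simp
  next
    case (step y z)
    then obtain u v where "(y, u) \<in> \<alpha>" "(u, v) \<in> \<beta>" "(v, z) \<in> \<alpha>" by blast
    with assms(6)[OF step.IH, of u] assms(6)[of u v] assms(6)[of v z] show ?case by simp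
  qed
qed

text \<open>Gumm's shifting lemma. The path \<open>x\<close>, \<open>z\<close>, \<open>u\<close>,
  \<open>y\<close> puts \<open>(x, y)\<close> into the join of
  \<open>\<alpha> \<inter> \<gamma>\<close> with \<psi>. By modularity the meet of this join with
  \<alpha> is the join of \<open>\<alpha> \<inter> \<gamma>\<close> with
  \<open>\<psi> \<inter> \<alpha>\<close>, and both of these lie below \<gamma>.\<close>

lemma modular_shift:
  assumes B: "algebra ar B" "modular_Con ar B"
    and \<alpha>: "\<alpha> \<in> Con ar B" and \<psi>: "\<psi> \<in> Con ar B" and \<gamma>: "\<gamma> \<in> Con ar B"
    and "\<alpha> \<inter> \<psi> \<subseteq> \<gamma>"
    and "(x, y) \<in> \<alpha>" "(z, u) \<in> \<alpha>" "(x, z) \<in> \<psi>" "(y, u) \<in> \<psi>" "(z, u) \<in> \<gamma>"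
  shows "(x, y) \<in> \<gamma>"
proof -
  let ?J = "join ar B (\<alpha> \<inter> \<gamma>) \<psi>"
  have \<alpha>\<gamma>: "\<alpha> \<inter> \<gamma> \<in> Con ar B" using Con_Int B \<alpha> \<gamma> by blast
  have J: "?J \<in> Con ar B" by (rule join_Con[OF B(1)])
  have "(x, z) \<in> ?J" "(z, u) \<in> ?J" "(u, y) \<in> ?J"
    using assms join_upper1[OF \<alpha>\<gamma> \<psi>] join_upper2[OF \<alpha>\<gamma> \<psi>] Con_sym[OF \<psi>] by blast+
  then have "(x, y) \<in> ?J \<inter> \<alpha>" using Con_trans[OF J] assms by blast
  also have "?J \<inter> \<alpha> = join ar B (\<alpha> \<inter> \<gamma>) (\<psi> \<inter> \<alpha>)"
    using B(2) \<alpha> \<psi> \<alpha>\<gamma> by (simp add: modular_Con_def)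
  also have "\<dots> \<subseteq> \<gamma>" using assms by (intro join_least) auto
  finally show ?thesis .
qed

text \<open>The joins of finite subfamilies of \<open>S\<close> are directed and their union is a
  congruence above all members of \<open>S\<close>. Finitely many generators below the join of
  \<open>S\<close> therefore lie in a single finite join.\<close>

lemma Cg_finite_compact:
  assumes B: "algebra ar B" and R: "finite R" "R \<subseteq> Nabla B"
  shows "Cg ar B R \<in> K ar B"
proof -
  have "\<exists>T\<subseteq>S. finite T \<and> Cg ar B R \<subseteq> Join ar B T"
    if S: "S \<subseteq> Con ar B" and le: "Cg ar B R \<subseteq> Join ar B S" for S
  proof -
    let ?D = "Join ar B ` {T. finite T \<and> T \<subseteq> S}"
    have mono: "Join ar B T \<subseteq> Join ar B T'" if "T \<subseteq> T'" for T T'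
      using Union_mono[OF that] unfolding Join_def Cg_def by blast
    have dir: "\<exists>Z\<in>?D. X \<union> Y \<subseteq> Z" if "X \<in> ?D" "Y \<in> ?D" for X Y
    proof -
      obtain T T' where "finite T" "T \<subseteq> S" "X = Join ar B T" "finite T'" "T' \<subseteq> S" "Y = Join ar B T'"
        using \<open>X \<in> ?D\<close> \<open>Y \<in> ?D\<close> by auto
      then show ?thesis using mono[of T "T \<union> T'"] mono[of T' "T \<union> T'"]
        by (intro bexI[of _ "Join ar B (T \<union> T')"]) auto
    qed
    have "\<Union>?D \<in> Con ar B"
      using B dir by (intro Con_directed_Union) (auto simp: Join_def Cg_Con)
    moreover have "\<Union>S \<subseteq> \<Union>?D"
    proof
      fix p assume "p \<in> \<Union>S"
      then obtain \<alpha> where "\<alpha> \<in> S" "p \<in> \<alpha>" by blast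
      moreover have "\<alpha> \<subseteq> Join ar B {\<alpha>}"
        unfolding Join_def using Cg_upper[of \<alpha> B ar] Con_subset \<open>\<alpha> \<in> S\<close> S by auto
      ultimately show "p \<in> \<Union>?D" by (intro UnionI[of "Join ar B {\<alpha>}"]) auto
    qed
    ultimately have "Join ar B S \<subseteq> \<Union>?D" unfolding Join_def by (rule Cg_least)
    with le Cg_upper[OF R(2)] have "R \<subseteq> \<Union>?D" by blast
    moreover have "?D \<noteq> {}" by auto
    ultimately have "\<exists>Z\<in>?D. R \<subseteq> Z"
    proof (induction rule: finite_induct[OF R(1)])
      case (2 p F)
      then obtain X Y where "X \<in> ?D" "p \<in> X" "Y \<in> ?D" "F \<subseteq> Y" by auto
      then show ?case using dir[of X Y] by blast
    qed auto
    then obtain T where "finite T" "T \<subseteq> S" "R \<subseteq> Join ar B T" by auto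
    then show ?thesis using Cg_least[of "Join ar B T" ar B R] B
      by (auto simp: Join_def Cg_Con)
  qed
  then show ?thesis by (simp add: K_def Cg_Con[OF B])
qed

section \<open>Terms and homomorphic images\<close>

lemma eval_carrier:
  "algebra ar B \<Longrightarrow> wf_term ar t \<Longrightarrow> range v \<subseteq> carrier B \<Longrightarrow> eval B v t \<in> carrier B"
  by (induction t) (auto intro!: algebra_ops)

lemma eval_Con:
  assumes "\<theta> \<in> Con ar B" and "\<And>x. (v x, w x) \<in> \<theta>" and "wf_term ar t"
  shows "(eval B v t, eval B w t) \<in> \<theta>"
  using assms(3)
proof (induction t)
  case (App f ts)
  then show ?case using Con_ops[OF assms(1), of "map (eval B v) ts" f "map (eval B w) ts"]
    by (auto simp: list_all2_conv_all_nth)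
qed (simp add: assms)

lemma eval_map_term: "eval B v (map_term id g t) = eval B (v \<circ> g) t"
  by (induction t) (auto simp: comp_def intro!: arg_cong[where f = "ops B _"])

lemma wf_map_term: "wf_term ar (map_term id g t) = wf_term ar t"
  by (induction t) auto

text \<open>Quotient maps, coordinate projections of pair algebras and re-codings on another type
  are all treated as instances of this notion.\<close>

definition surhom :: "('f \<Rightarrow> nat) \<Rightarrow> ('a \<Rightarrow> 'b) \<Rightarrow> ('a, 'f) alg \<Rightarrow> ('b, 'f) alg \<Rightarrow> bool" where
  "surhom ar h B C \<longleftrightarrow> carrier C = h ` carrier B \<and>
     (\<forall>f xs. length xs = ar f \<and> set xs \<subseteq> carrier B \<longrightarrow> ops C f (map h xs) = h (ops B f xs))"

text \<open>The restriction to \<open>Nabla B\<close> makes \<open>pull h B Id\<close> the kernel of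
  \<open>h\<close> on the carrier; kernels are written in this form below.\<close>

definition pull :: "('a \<Rightarrow> 'b) \<Rightarrow> ('a, 'f) alg \<Rightarrow> ('b \<times> 'b) set \<Rightarrow> ('a \<times> 'a) set" where
  "pull h B \<phi> = {(x, y) \<in> Nabla B. (h x, h y) \<in> \<phi>}"

definition push :: "('a \<Rightarrow> 'b) \<Rightarrow> ('a \<times> 'a) set \<Rightarrow> ('b \<times> 'b) set" where
  "push h \<chi> = map_prod h h ` \<chi>"

lemma surhom_carrier: "surhom ar h B C \<Longrightarrow> carrier C = h ` carrier B"
  by (simp add: surhom_def)

lemma surhom_ops:
  "surhom ar h B C \<Longrightarrow> length xs = ar f \<Longrightarrow> set xs \<subseteq> carrier B
    \<Longrightarrow> ops C f (map h xs) = h (ops B f xs)"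
  by (simp add: surhom_def)

lemma surhom_lift_list:
  assumes "surhom ar h B C" and "set ys \<subseteq> carrier C"
  obtains xs where "ys = map h xs" "set xs \<subseteq> carrier B"
proof -
  have "ys \<in> map h ` lists (carrier B)"
    using assms by (auto simp: surhom_def simp flip: lists_image)
  then show ?thesis using that by auto
qed

lemma surhom_lift_fun:
  assumes "surhom ar h B C" and "range w \<subseteq> carrier C"
  obtains v where "range v \<subseteq> carrier B" "w = h \<circ> v"
proof -
  have "\<forall>x. \<exists>y. y \<in> carrier B \<and> w x = h y"
    using assms by (force simp: surhom_def)
  then obtain v where "\<forall>x. v x \<in> carrier B \<and> w x = h (v x)" by metis
  then show ?thesis using that[of v] by (auto simp: fun_eq_iff)
qed

lemma surhom_algebra:
  assumes B: "algebra ar B" and h: "surhom ar h B C"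
  shows "algebra ar C"
  unfolding algebra_def
proof (intro conjI allI impI)
  show "carrier C \<noteq> {}" using B h by (simp add: surhom_def algebra_def)
  fix f ys assume ys: "length ys = ar f \<and> set ys \<subseteq> carrier C"
  then obtain xs where "ys = map h xs" "set xs \<subseteq> carrier B"
    using surhom_lift_list[OF h] by blast
  then show "ops C f ys \<in> carrier C"
    using ys algebra_ops[OF B, of xs f] h by (simp add: surhom_def)
qed

lemma surhom_eval:
  assumes B: "algebra ar B" and h: "surhom ar h B C"
    and "wf_term ar t" and v: "range v \<subseteq> carrier B"
  shows "eval C (h \<circ> v) t = h (eval B v t)"
  using assms(3)
proof (induction t)
  case (App f ts)
  then have "map (eval C (h \<circ> v)) ts = map h (map (eval B v) ts)" by (simp add: comp_def)
  moreover have "set (map (eval B v) ts) \<subseteq> carrier B"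
    using App.prems eval_carrier[OF B _ v] by auto
  ultimately show ?case
    using surhom_ops[OF h, of "map (eval B v) ts" f] App.prems
    by (simp only: eval.simps wf_term.simps length_map)
qed simp

text \<open>Varieties are closed under homomorphic images: valuations into \<open>C\<close> lift
  through \<open>h\<close>, and \<open>h\<close> commutes with the evaluation of well-formed
  terms.\<close>

lemma surhom_inV:
  assumes wf: "\<forall>(s, t)\<in>Eqs. wf_term ar s \<and> wf_term ar t"
    and B: "inV ar Eqs B" and h: "surhom ar h B C"
  shows "inV ar Eqs C"
proof -
  have alg: "algebra ar B" using B by (simp add: inV_def)
  have "eval C w s = eval C w t" if st: "(s, t) \<in> Eqs" and w: "range w \<subseteq> carrier C" for s t w
  proof -
    obtain v where v: "range v \<subseteq> carrier B" "w = h \<circ> v" by (rule surhom_lift_fun[OF h w])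
    moreover have "eval B v s = eval B v t" using B st v by (auto simp: inV_def)
    moreover have "wf_term ar s" "wf_term ar t" using st wf by auto
    ultimately show ?thesis using surhom_eval[OF alg h] by metis
  qed
  then show ?thesis using surhom_algebra[OF alg h] by (auto simp: inV_def)
qed

text \<open>Transport of structure: any function whose kernel on the carrier is a congruence carries
  the quotient onto its image. This is how algebras are realised on a type to which the standing
  assumptions apply.\<close>

lemma surhom_exists:
  assumes B: "algebra ar B" and \<theta>: "\<theta> \<in> Con ar B"
    and ker: "\<And>x y. x \<in> carrier B \<Longrightarrow> y \<in> carrier B \<Longrightarrow> h x = h y \<longleftrightarrow> (x, y) \<in> \<theta>"
  obtains C where "surhom ar h B C"
proof -
  let ?g = "inv_into (carrier B) h"
  let ?C = "\<lparr>carrier = h ` carrier B, ops = \<lambda>f ys. h (ops B f (map ?g ys))\<rparr>"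
  have "h (ops B f (map ?g (map h xs))) = h (ops B f xs)"
    if "length xs = ar f" "set xs \<subseteq> carrier B" for f xs
  proof -
    have g: "?g (h x) \<in> carrier B" "(?g (h x), x) \<in> \<theta>" if "x \<in> carrier B" for x
      using that inv_into_into[of "h x" h "carrier B"] f_inv_into_f[of "h x" h "carrier B"] ker
      by auto
    have "(ops B f (map ?g (map h xs)), ops B f xs) \<in> \<theta>"
      using that g by (intro Con_ops[OF \<theta>]) (auto simp: list_all2_conv_all_nth subset_iff)
    then show ?thesis using ker Con_carrier[OF \<theta>] by blast
  qed
  then have "surhom ar h B ?C" by (simp add: surhom_def)
  then show ?thesis by (rule that)
qed

lemma pull_Con:
  assumes B: "algebra ar B" and h: "surhom ar h B C" and \<phi>: "\<phi> \<in> Con ar C"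
  shows "pull h B \<phi> \<in> Con ar B"
proof (rule ConI)
  show "pull h B \<phi> \<subseteq> Nabla B" by (auto simp: pull_def)
  show "(x, x) \<in> pull h B \<phi>" if "x \<in> carrier B" for x
    using that Con_refl[OF \<phi>] h by (auto simp: pull_def Nabla_def surhom_def)
  show "(y, x) \<in> pull h B \<phi>" if "(x, y) \<in> pull h B \<phi>" for x y
    using that Con_sym[OF \<phi>] by (auto simp: pull_def Nabla_def)
  show "(x, z) \<in> pull h B \<phi>" if "(x, y) \<in> pull h B \<phi>" "(y, z) \<in> pull h B \<phi>" for x y z
    using that Con_trans[OF \<phi>] by (auto simp: pull_def Nabla_def)
  fix f xs ys
  assume len: "length xs = ar f" and l: "list_all2 (\<lambda>x y. (x, y) \<in> pull h B \<phi>) xs ys"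
  have car: "set xs \<subseteq> carrier B \<and> set ys \<subseteq> carrier B"
    by (rule list_all2_NablaD[OF l]) (auto simp: pull_def)
  have len': "length ys = ar f" using list_all2_lengthD[OF l] len by simp
  have "(ops C f (map h xs), ops C f (map h ys)) \<in> \<phi>"
    using l len by (intro Con_ops[OF \<phi>]) (auto simp: list_all2_conv_all_nth pull_def)
  then show "(ops B f xs, ops B f ys) \<in> pull h B \<phi>"
    using len len' car surhom_ops[OF h] algebra_ops[OF B] by (simp add: pull_def Nabla_def)
qed

text \<open>Together with \<open>push_pull\<close>, \<open>pull_Con\<close> and
  \<open>push_Con\<close> this is the correspondence theorem: congruences of the image match the
  congruences above the kernel.\<close>

lemma pull_push:
  assumes \<chi>: "\<chi> \<in> Con ar B" and ker: "pull h B Id \<subseteq> \<chi>"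
  shows "pull h B (push h \<chi>) = \<chi>"
proof
  show "\<chi> \<subseteq> pull h B (push h \<chi>)" using Con_subset[OF \<chi>] by (auto simp: pull_def push_def)
  show "pull h B (push h \<chi>) \<subseteq> \<chi>"
  proof clarify
    fix x y assume "(x, y) \<in> pull h B (push h \<chi>)"
    then obtain u v where *: "(x, y) \<in> Nabla B" "h x = h u" "h y = h v" "(u, v) \<in> \<chi>"
      by (auto simp: pull_def push_def)
    then have "(x, u) \<in> \<chi>" "(v, y) \<in> \<chi>"
      using ker Con_carrier[OF \<chi> *(4)] by (auto simp: pull_def Nabla_def)
    then show "(x, y) \<in> \<chi>" using *(4) Con_trans[OF \<chi>] by blast
  qed
qed

lemma push_pull:
  assumes h: "surhom ar h B C" and \<phi>: "\<phi> \<subseteq> Nabla C"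
  shows "push h (pull h B \<phi>) = \<phi>"
proof
  show "push h (pull h B \<phi>) \<subseteq> \<phi>" by (auto simp: pull_def push_def)
  show "\<phi> \<subseteq> push h (pull h B \<phi>)"
  proof clarify
    fix u v assume "(u, v) \<in> \<phi>"
    moreover from this obtain x y where "u = h x" "v = h y" "x \<in> carrier B" "y \<in> carrier B"
      using \<phi> surhom_carrier[OF h] by (auto simp: Nabla_def)
    ultimately show "(u, v) \<in> push h (pull h B \<phi>)"
      unfolding push_def pull_def by (intro image_eqI[of _ _ "(x, y)"]) (auto simp: Nabla_def)
  qed
qed

lemma push_Con:
  assumes B: "algebra ar B" and h: "surhom ar h B C"
    and \<chi>: "\<chi> \<in> Con ar B" and ker: "pull h B Id \<subseteq> \<chi>"
  shows "push h \<chi> \<in> Con ar C"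
proof -
  \<comment> \<open>As \<chi> contains the kernel, membership in its image can be tested on
    arbitrary preimages.\<close>
  have iff: "(h x, h y) \<in> push h \<chi> \<longleftrightarrow> (x, y) \<in> \<chi>" if "x \<in> carrier B" "y \<in> carrier B" for x y
    using pull_push[OF \<chi> ker] that by (auto simp: pull_def Nabla_def)
  have sub: "push h \<chi> \<subseteq> Nabla C"
    using Con_subset[OF \<chi>] h by (auto simp: push_def Nabla_def surhom_def)
  show ?thesis
  proof (rule ConI[OF sub])
    show "(u, u) \<in> push h \<chi>" if "u \<in> carrier C" for u
      using that h Con_refl[OF \<chi>] iff by (auto simp: surhom_def)
    show "(v, u) \<in> push h \<chi>" if "(u, v) \<in> push h \<chi>" for u v
      using that Con_sym[OF \<chi>] by (force simp: push_def)
    show "(u, w) \<in> push h \<chi>" if uv: "(u, v) \<in> push h \<chi>" and vw: "(v, w) \<in> push h \<chi>" for u v w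
    proof -
      have "u \<in> carrier C" "v \<in> carrier C" "w \<in> carrier C"
        using uv vw sub by (auto simp: Nabla_def)
      then obtain x y z where "u = h x" "v = h y" "w = h z"
        "x \<in> carrier B" "y \<in> carrier B" "z \<in> carrier B"
        using surhom_carrier[OF h] by auto
      then show ?thesis using uv vw iff Con_trans[OF \<chi>] by metis
    qed
    fix f us vs
    assume len: "length us = ar f" and l: "list_all2 (\<lambda>x y. (x, y) \<in> push h \<chi>) us vs"
    have len': "length vs = ar f" using list_all2_lengthD[OF l] len by simp
    have car: "set us \<subseteq> carrier C \<and> set vs \<subseteq> carrier C" by (rule list_all2_NablaD[OF l sub])
    obtain xs where xs: "us = map h xs" "set xs \<subseteq> carrier B"
      using surhom_lift_list[OF h] car by blast
    obtain ys where ys: "vs = map h ys" "set ys \<subseteq> carrier B"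
      using surhom_lift_list[OF h] car by blast
    have "list_all2 (\<lambda>x y. (x, y) \<in> \<chi>) xs ys"
      unfolding list_all2_conv_all_nth
    proof (intro conjI allI impI)
      show "length xs = length ys" using len len' xs ys by simp
      fix i assume "i < length xs"
      then have "(h (xs ! i), h (ys ! i)) \<in> push h \<chi>" "xs ! i \<in> carrier B" "ys ! i \<in> carrier B"
        using l xs ys len len' by (auto simp: list_all2_conv_all_nth subset_iff)
      then show "(xs ! i, ys ! i) \<in> \<chi>" using iff by blast
    qed
    then have "(ops B f xs, ops B f ys) \<in> \<chi>" using len xs by (intro Con_ops[OF \<chi>]) auto
    then have "(h (ops B f xs), h (ops B f ys)) \<in> push h \<chi>" by (force simp: push_def)
    then show "(ops C f us, ops C f vs) \<in> push h \<chi>"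
      using xs ys len len' surhom_ops[OF h] by simp
  qed
qed

lemma push_mono: "\<alpha> \<subseteq> \<beta> \<Longrightarrow> push h \<alpha> \<subseteq> push h \<beta>"
  by (auto simp: push_def)

lemma pull_mono: "\<alpha> \<subseteq> \<beta> \<Longrightarrow> pull h B \<alpha> \<subseteq> pull h B \<beta>"
  by (auto simp: pull_def)

text \<open>Modularity is available only for the re-coded copy \<open>C\<close>. An injective
  \<open>h\<close> is an isomorphism onto it, so the shifting configuration is pushed forward and
  its conclusion read back.\<close>

lemma surhom_shift:
  assumes B: "algebra ar B" and h: "surhom ar h B C" "inj_on h (carrier B)"
    and C: "modular_Con ar C"
    and \<alpha>: "\<alpha> \<in> Con ar B" and \<psi>: "\<psi> \<in> Con ar B" and \<gamma>: "\<gamma> \<in> Con ar B"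
    and le: "\<alpha> \<inter> \<psi> \<subseteq> \<gamma>"
    and xyzu: "(x, y) \<in> \<alpha>" "(z, u) \<in> \<alpha>" "(x, z) \<in> \<psi>" "(y, u) \<in> \<psi>" "(z, u) \<in> \<gamma>"
  shows "(x, y) \<in> \<gamma>"
proof -
  have "pull h B Id \<subseteq> \<theta>" if "\<theta> \<in> Con ar B" for \<theta>
    using h(2) Con_refl[OF that] by (auto simp: pull_def Nabla_def dest: inj_onD)
  note push = push_Con[OF B h(1) _ this] pull_push[OF _ this]
  have iff: "(h a, h b) \<in> push h \<theta> \<longleftrightarrow> (a, b) \<in> \<theta>"
    if "\<theta> \<in> Con ar B" "a \<in> carrier B" "b \<in> carrier B" for \<theta> a b
    using push(2)[OF that(1) that(1)] that by (auto simp: pull_def Nabla_def)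
  have car: "x \<in> carrier B" "y \<in> carrier B" "z \<in> carrier B" "u \<in> carrier B"
    using xyzu Con_carrier[OF \<alpha>] by auto
  have "push h \<alpha> \<inter> push h \<psi> \<subseteq> push h \<gamma>"
  proof clarify
    fix a b assume ab: "(a, b) \<in> push h \<alpha>" "(a, b) \<in> push h \<psi>"
    then obtain a' b' where *: "a = h a'" "b = h b'" "(a', b') \<in> \<alpha>" by (auto simp: push_def)
    then have "(a', b') \<in> \<psi>" using ab iff[OF \<psi>] Con_carrier[OF \<alpha> *(3)] by auto
    then show "(a, b) \<in> push h \<gamma>" using * le iff[OF \<gamma>] Con_carrier[OF \<alpha> *(3)] by auto
  qed
  from modular_shift[OF surhom_algebra[OF B h(1)] C push(1)[OF \<alpha> \<alpha>] push(1)[OF \<psi> \<psi>] push(1)[OF \<gamma> \<gamma>] this,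
      of "h x" "h y" "h z" "h u"]
  show ?thesis using xyzu car iff \<alpha> \<psi> \<gamma> by simp
qed

section \<open>A congruence as a subalgebra of the square\<close>

definition pair_alg :: "('a, 'f) alg \<Rightarrow> ('a \<times> 'a) set \<Rightarrow> ('a \<times> 'a, 'f) alg" where
  "pair_alg B \<beta> = \<lparr>carrier = \<beta>, ops = \<lambda>f ps. (ops B f (map fst ps), ops B f (map snd ps))\<rparr>"

lemma pair_alg_simps [simp]:
  "carrier (pair_alg B \<beta>) = \<beta>"
  "ops (pair_alg B \<beta>) f ps = (ops B f (map fst ps), ops B f (map snd ps))"
  "Nabla (pair_alg B \<beta>) = \<beta> \<times> \<beta>"
  by (simp_all add: pair_alg_def Nabla_def)

lemma pair_alg_eval:
  "eval (pair_alg B \<beta>) v t = (eval B (fst \<circ> v) t, eval B (snd \<circ> v) t)"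
  by (induction t) (auto simp: comp_def intro!: arg_cong[where f = "ops B _"])

lemma pair_alg_algebra:
  assumes "algebra ar B" and \<beta>: "\<beta> \<in> Con ar B"
  shows "algebra ar (pair_alg B \<beta>)"
proof -
  have "\<beta> \<noteq> {}" using assms Con_refl[OF \<beta>] by (auto simp: algebra_def)
  moreover have "(ops B f (map fst ps), ops B f (map snd ps)) \<in> \<beta>"
    if "length ps = ar f" "set ps \<subseteq> \<beta>" for f ps
    using that by (intro Con_ops[OF \<beta>]) (auto simp: list_all2_conv_all_nth dest!: nth_mem)
  ultimately show ?thesis by (simp add: algebra_def)
qed

lemma pair_alg_inV:
  assumes B: "inV ar Eqs B" and \<beta>: "\<beta> \<in> Con ar B"
  shows "inV ar Eqs (pair_alg B \<beta>)"
proof -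
  have "range (fst \<circ> v) \<subseteq> carrier B \<and> range (snd \<circ> v) \<subseteq> carrier B" if "range v \<subseteq> \<beta>" for v :: "nat \<Rightarrow> _"
    using that Con_subset[OF \<beta>] by (fastforce simp: Nabla_def)
  then show ?thesis
    using B pair_alg_algebra[OF _ \<beta>] by (fastforce simp: inV_def pair_alg_eval)
qed

text \<open>This is the congruence written as a doubly indexed \<Delta> in commutator theory. Its
  elements are pairs of rows: each row is \<beta>-related, and the generators join the constant rows
  of \<alpha>-related elements.\<close>

definition diag_con ::
  "('f \<Rightarrow> nat) \<Rightarrow> ('a, 'f) alg \<Rightarrow> ('a \<times> 'a) set \<Rightarrow> ('a \<times> 'a) set \<Rightarrow> (('a \<times> 'a) \<times> 'a \<times> 'a) set"
  where "diag_con ar B \<beta> \<alpha> = Cg ar (pair_alg B \<beta>) {((x, x), (y, y)) | x y. (x, y) \<in> \<alpha>}"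

lemma diag_con_Con:
  "algebra ar B \<Longrightarrow> \<beta> \<in> Con ar B \<Longrightarrow> diag_con ar B \<beta> \<alpha> \<in> Con ar (pair_alg B \<beta>)"
  by (simp add: diag_con_def Cg_Con pair_alg_algebra)

lemma diag_con_diag:
  assumes "\<beta> \<in> Con ar B" and \<alpha>: "\<alpha> \<in> Con ar B" and "(x, y) \<in> \<alpha>"
  shows "((x, x), (y, y)) \<in> diag_con ar B \<beta> \<alpha>"
  using Cg_upper[of "{((x, x), (y, y)) | x y. (x, y) \<in> \<alpha>}" "pair_alg B \<beta>" ar] assms
  by (auto simp: diag_con_def dest: Con_carrier[OF \<alpha>] intro: Con_refl)

text \<open>The rows of a matrix are two values of \<open>t\<close> in the pair algebra. The
  \<alpha>-variables receive diagonal pairs, which the generators relate; the \<beta>-variables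
  receive the same pair \<open>(c j, d j)\<close> in both rows.\<close>

lemma diag_con_matrix:
  fixes B :: "('a, 'f) alg" and t :: "('f, 'v + 'w) term"
  assumes B: "algebra ar B" and \<alpha>: "\<alpha> \<in> Con ar B" and \<beta>: "\<beta> \<in> Con ar B"
    and t: "wf_term ar t" and ab: "\<And>i. (a i, b i) \<in> \<alpha>" and cd: "\<And>j. (c j, d j) \<in> \<beta>"
  shows "((eval B (case_sum a c) t, eval B (case_sum a d) t),
          (eval B (case_sum b c) t, eval B (case_sum b d) t)) \<in> diag_con ar B \<beta> \<alpha>"
proof -
  let ?v = "case_sum (\<lambda>i. (a i, a i)) (\<lambda>j. (c j, d j))"
  let ?w = "case_sum (\<lambda>i. (b i, b i)) (\<lambda>j. (c j, d j))"
  note D = diag_con_Con[OF B \<beta>]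
  have "(?v x, ?w x) \<in> diag_con ar B \<beta> \<alpha>" for x
    using diag_con_diag[OF \<beta> \<alpha> ab] Con_refl[OF D] cd by (cases x) auto
  then have "(eval (pair_alg B \<beta>) ?v t, eval (pair_alg B \<beta>) ?w t) \<in> diag_con ar B \<beta> \<alpha>"
    by (rule eval_Con[OF D]) (rule t)
  moreover have "fst \<circ> case_sum (\<lambda>i. (e i, e i)) (\<lambda>j. (c j, d j)) = case_sum e c"
    "snd \<circ> case_sum (\<lambda>i. (e i, e i)) (\<lambda>j. (c j, d j)) = case_sum e d" for e :: "'v \<Rightarrow> 'a"
    by (auto simp: fun_eq_iff split: sum.split)
  ultimately show ?thesis by (simp add: pair_alg_eval)
qed

text \<open>Exchanging coordinates is an automorphism of the pair algebra, since \<beta> is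
  symmetric, and it fixes every generator.\<close>

lemma diag_con_swap:
  assumes B: "algebra ar B" and \<alpha>: "\<alpha> \<in> Con ar B" and \<beta>: "\<beta> \<in> Con ar B"
    and pq: "((x, y), (z, u)) \<in> diag_con ar B \<beta> \<alpha>"
  shows "((y, x), (u, z)) \<in> diag_con ar B \<beta> \<alpha>"
proof -
  let ?D = "diag_con ar B \<beta> \<alpha>" and ?P = "pair_alg B \<beta>"
  note P = pair_alg_algebra[OF B \<beta>]
  have "prod.swap ` \<beta> = \<beta>" using Con_sym[OF \<beta>] by force
  then have "surhom ar prod.swap ?P ?P" by (simp add: surhom_def comp_def)
  then have "pull prod.swap ?P ?D \<in> Con ar ?P" using diag_con_Con[OF B \<beta>] by (rule pull_Con[OF P])
  moreover have "{((x, x), (y, y)) | x y. (x, y) \<in> \<alpha>} \<subseteq> pull prod.swap ?P ?D"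
    using diag_con_diag[OF \<beta> \<alpha>] Con_carrier[OF \<alpha>] Con_refl[OF \<beta>] by (auto simp: pull_def)
  ultimately have "?D \<subseteq> pull prod.swap ?P ?D" unfolding diag_con_def[of ar B \<beta> \<alpha>] by (rule Cg_least)
  then show ?thesis using pq by (auto simp: pull_def)
qed

text \<open>The matrices of the term condition, read as pairs of rows, form a reflexive symmetric
subalgebra of the square of the pair algebra, so their transitive closure is a congruence.\<close>

lemma diag_con_subset_matrices:
  fixes B :: "('a, 'f) alg"
  assumes B: "algebra ar B" and \<alpha>: "\<alpha> \<in> Con ar B" and \<beta>: "\<beta> \<in> Con ar B"
  shows "diag_con ar B \<beta> \<alpha> \<subseteq>
    {((eval B (case_sum a c) t, eval B (case_sum a d) t),
      (eval B (case_sum b c) t, eval B (case_sum b d) t)) | (t :: ('f, nat + nat) term) a b c d.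
      wf_term ar t \<and> (\<forall>i. (a i, b i) \<in> \<alpha>) \<and> (\<forall>j. (c j, d j) \<in> \<beta>)}\<^sup>+" (is "_ \<subseteq> ?M\<^sup>+")
proof -
  let ?P = "pair_alg B \<beta>"
  note P = pair_alg_algebra[OF B \<beta>]
  \<comment> \<open>A filler value for the variables that do not occur in the one-variable terms
    below.\<close>
  obtain x0 where x0: "x0 \<in> carrier B" using B by (auto simp: algebra_def)
  have diag: "((x, x), (y, y)) \<in> ?M" if "(x, y) \<in> \<alpha>" for x y
  proof -
    have "\<exists>(t :: ('f, nat + nat) term) a b c d. ((x, x), (y, y)) =
        ((eval B (case_sum a c) t, eval B (case_sum a d) t),
         (eval B (case_sum b c) t, eval B (case_sum b d) t)) \<and>
      wf_term ar t \<and> (\<forall>i. (a i, b i) \<in> \<alpha>) \<and> (\<forall>j. (c j, d j) \<in> \<beta>)"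
      using that x0 Con_refl[OF \<beta>]
      by (intro exI[of _ "Var (Inl 0)"] exI[of _ "\<lambda>_. x"] exI[of _ "\<lambda>_. y"] exI[of _ "\<lambda>_. x0"]) auto
    then show ?thesis by blast
  qed
  have "?M\<^sup>+ \<in> Con ar ?P"
  proof (rule Con_trancl[OF P])
    show "?M \<subseteq> Nabla ?P"
    proof clarify
      fix t :: "('f, nat + nat) term" and a b c d :: "nat \<Rightarrow> 'a"
      assume *: "wf_term ar t" "\<forall>i. (a i, b i) \<in> \<alpha>" "\<forall>j. (c j, d j) \<in> \<beta>"
      have "(eval B (case_sum e c) t, eval B (case_sum e d) t) \<in> \<beta>" if "range e \<subseteq> carrier B" for e
      proof (rule eval_Con[OF \<beta> _ *(1)])
        show "(case_sum e c x, case_sum e d x) \<in> \<beta>" for x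
          using that *(3) Con_refl[OF \<beta>] by (cases x) auto
      qed
      moreover have "range a \<subseteq> carrier B" "range b \<subseteq> carrier B"
        using *(2) Con_carrier[OF \<alpha>] by blast+
      ultimately show "((eval B (case_sum a c) t, eval B (case_sum a d) t),
          (eval B (case_sum b c) t, eval B (case_sum b d) t)) \<in> Nabla ?P" by simp
    qed
    show "(p, p) \<in> ?M" if "p \<in> carrier ?P" for p
    proof -
      have "\<exists>(t :: ('f, nat + nat) term) a b c d. (p, p) =
          ((eval B (case_sum a c) t, eval B (case_sum a d) t),
           (eval B (case_sum b c) t, eval B (case_sum b d) t)) \<and>
        wf_term ar t \<and> (\<forall>i. (a i, b i) \<in> \<alpha>) \<and> (\<forall>j. (c j, d j) \<in> \<beta>)"
        using that x0 Con_refl[OF \<alpha>]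
        by (intro exI[of _ "Var (Inr 0)"] exI[of _ "\<lambda>_. x0"] exI[of _ "\<lambda>_. fst p"] exI[of _ "\<lambda>_. snd p"])
           auto
      then show ?thesis by blast
    qed
    show "(q, p) \<in> ?M" if "(p, q) \<in> ?M" for p q
      using that Con_sym[OF \<alpha>] by blast
    fix f ps qs
    assume len: "length ps = ar f" and l: "list_all2 (\<lambda>p q. (p, q) \<in> ?M) ps qs"
    have "\<forall>k. \<exists>(t :: ('f, nat + nat) term) a b c d. (k < ar f \<longrightarrow> (ps ! k, qs ! k) =
          ((eval B (case_sum a c) t, eval B (case_sum a d) t),
           (eval B (case_sum b c) t, eval B (case_sum b d) t))) \<and>
        wf_term ar t \<and> (\<forall>i. (a i, b i) \<in> \<alpha>) \<and> (\<forall>j. (c j, d j) \<in> \<beta>)"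
    proof
      fix k
      \<comment> \<open>Beyond the arity any matrix will do; a dummy there allows terms and
        valuations to be chosen for all \<open>k\<close> at once.\<close>
      have "\<exists>r\<in>?M. k < ar f \<longrightarrow> (ps ! k, qs ! k) = r"
      proof (cases "k < ar f")
        case True
        then show ?thesis using l len by (auto simp: list_all2_conv_all_nth)
      next
        case False
        then show ?thesis using diag[OF Con_refl[OF \<alpha> x0]] by blast
      qed
      then show "\<exists>(t :: ('f, nat + nat) term) a b c d. (k < ar f \<longrightarrow> (ps ! k, qs ! k) =
          ((eval B (case_sum a c) t, eval B (case_sum a d) t),
           (eval B (case_sum b c) t, eval B (case_sum b d) t))) \<and>
        wf_term ar t \<and> (\<forall>i. (a i, b i) \<in> \<alpha>) \<and> (\<forall>j. (c j, d j) \<in> \<beta>)"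
        by blast
    qed
    then obtain t :: "nat \<Rightarrow> ('f, nat + nat) term" and a b c d where
      mat: "\<And>k. k < ar f \<Longrightarrow> (ps ! k, qs ! k) =
          ((eval B (case_sum (a k) (c k)) (t k), eval B (case_sum (a k) (d k)) (t k)),
           (eval B (case_sum (b k) (c k)) (t k), eval B (case_sum (b k) (d k)) (t k)))"
      and wf: "\<And>k. wf_term ar (t k)"
      and ab: "\<And>k i. (a k i, b k i) \<in> \<alpha>" and cd: "\<And>k j. (c k j, d k j) \<in> \<beta>"
      by metis
    \<comment> \<open>The matrices for the single arguments use different terms and valuations.
      Coding variable \<open>i\<close> of the \<open>k\<close>-th term as
      \<open>prod_encode (k, i)\<close> keeps the variables apart, so that all matrices merge into
      one for the term \<open>s\<close>, under the combined valuations \<open>unc\<close>.\<close>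
    define ren where "ren k = map_sum (\<lambda>i. prod_encode (k, i)) (\<lambda>i. prod_encode (k, i))"
      for k :: nat
    define unc where "unc e n = e (fst (prod_decode n)) (snd (prod_decode n))"
      for e :: "nat \<Rightarrow> nat \<Rightarrow> 'a" and n
    define s where "s = App f (map (\<lambda>k. map_term id (ren k) (t k)) [0..<ar f])"
    have unc: "case_sum (unc e) (unc e') \<circ> ren k = case_sum (e k) (e' k)" for e e' k
      by (auto simp: fun_eq_iff unc_def ren_def split: sum.split)
    have s: "eval B (case_sum (unc e) (unc e')) s
        = ops B f (map (\<lambda>k. eval B (case_sum (e k) (e' k)) (t k)) [0..<ar f])" for e e'
      by (simp add: s_def comp_def eval_map_term unc[unfolded comp_def])
    have len': "length qs = ar f" using list_all2_lengthD[OF l] len by simp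
    have nth: "map g rs = map (\<lambda>k. g (rs ! k)) [0..<ar f]" if "length rs = ar f"
      for g :: "'a \<times> 'a \<Rightarrow> 'a" and rs
      using that by (intro nth_equalityI) auto
    have maps: "map fst ps = map (\<lambda>k. eval B (case_sum (a k) (c k)) (t k)) [0..<ar f]"
      "map snd ps = map (\<lambda>k. eval B (case_sum (a k) (d k)) (t k)) [0..<ar f]"
      "map fst qs = map (\<lambda>k. eval B (case_sum (b k) (c k)) (t k)) [0..<ar f]"
      "map snd qs = map (\<lambda>k. eval B (case_sum (b k) (d k)) (t k)) [0..<ar f]"
      unfolding nth[OF len] nth[OF len'] using mat by simp_all
    have "wf_term ar s" using wf by (auto simp: s_def wf_map_term)
    moreover have "(ops ?P f ps, ops ?P f qs) =
        ((eval B (case_sum (unc a) (unc c)) s, eval B (case_sum (unc a) (unc d)) s),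
         (eval B (case_sum (unc b) (unc c)) s, eval B (case_sum (unc b) (unc d)) s))"
      by (simp add: s maps)
    moreover have "\<forall>i. (unc a i, unc b i) \<in> \<alpha>" "\<forall>j. (unc c j, unc d j) \<in> \<beta>"
      using ab cd by (simp_all add: unc_def)
    ultimately show "(ops ?P f ps, ops ?P f qs) \<in> ?M" by blast
  qed
  then show ?thesis unfolding diag_con_def by (rule Cg_least) (use diag in blast)
qed

text \<open>Matrices have their rows related by \<open>diag_con\<close>; conversely
  \<open>diag_con\<close> lies in the transitive closure of the matrices, and saturation passes
  along chains. The quantification over terms is thereby replaced by one congruence, to which the
  shifting lemma applies.\<close>

lemma centralizes_iff_saturated:
  fixes B :: "('a, 'f) alg"
  assumes B: "algebra ar B" and \<alpha>: "\<alpha> \<in> Con ar B" and \<beta>: "\<beta> \<in> Con ar B"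
  shows "centralizes ar B \<alpha> \<beta> \<delta> \<longleftrightarrow> (\<forall>(p, q) \<in> diag_con ar B \<beta> \<alpha>. p \<in> \<delta> \<longrightarrow> q \<in> \<delta>)"
proof
  assume C: "centralizes ar B \<alpha> \<beta> \<delta>"
  show "\<forall>(p, q) \<in> diag_con ar B \<beta> \<alpha>. p \<in> \<delta> \<longrightarrow> q \<in> \<delta>"
  proof (safe, goal_cases)
    case (1 p1 p2 q1 q2)
    have "((p1, p2), (q1, q2)) \<in> {((eval B (case_sum a c) t, eval B (case_sum a d) t),
      (eval B (case_sum b c) t, eval B (case_sum b d) t)) | (t :: ('f, nat + nat) term) a b c d.
      wf_term ar t \<and> (\<forall>i. (a i, b i) \<in> \<alpha>) \<and> (\<forall>j. (c j, d j) \<in> \<beta>)}\<^sup>+"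
      using 1(1) diag_con_subset_matrices[OF B \<alpha> \<beta>] by blast
    then show ?case using 1(2)
    proof (induction rule: trancl_induct)
      case (base y)
      then show ?case using C unfolding centralizes_def by blast
    next
      case (step y z)
      then show ?case using C unfolding centralizes_def by blast
    qed
  qed
next
  assume "\<forall>(p, q) \<in> diag_con ar B \<beta> \<alpha>. p \<in> \<delta> \<longrightarrow> q \<in> \<delta>"
  then show "centralizes ar B \<alpha> \<beta> \<delta>"
    unfolding centralizes_def using diag_con_matrix[OF B \<alpha> \<beta>] by blast
qed

section \<open>The commutator\<close>

text \<open>The columns of a matrix are \<alpha>-related, so going around it carries \<alpha> from
  the first row to the second. The second row is \<beta>-related in any case.\<close>

lemma centralizes_Int:
  assumes \<alpha>: "\<alpha> \<in> Con ar B" and \<beta>: "\<beta> \<in> Con ar B"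
  shows "centralizes ar B \<alpha> \<beta> (\<alpha> \<inter> \<beta>)"
  unfolding centralizes_def
proof (intro allI impI)
  fix t :: "('b, nat + nat) term" and a b c d
  assume t: "wf_term ar t" and ab: "\<forall>i. (a i, b i) \<in> \<alpha>" and cd: "\<forall>j. (c j, d j) \<in> \<beta>"
    and ac: "(eval B (case_sum a c) t, eval B (case_sum a d) t) \<in> \<alpha> \<inter> \<beta>"
  have "(eval B (case_sum a e) t, eval B (case_sum b e) t) \<in> \<alpha>" if "range e \<subseteq> carrier B" for e
  proof (rule eval_Con[OF \<alpha> _ t])
    show "(case_sum a e x, case_sum b e x) \<in> \<alpha>" for x
      using ab that Con_refl[OF \<alpha>] by (cases x) auto
  qed
  moreover have "range c \<subseteq> carrier B" "range d \<subseteq> carrier B" using cd Con_carrier[OF \<beta>] by blast+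
  ultimately have "(eval B (case_sum a c) t, eval B (case_sum b c) t) \<in> \<alpha>"
    "(eval B (case_sum a d) t, eval B (case_sum b d) t) \<in> \<alpha>" by blast+
  then have "(eval B (case_sum b c) t, eval B (case_sum b d) t) \<in> \<alpha>"
    using ac by (meson IntD1 Con_sym[OF \<alpha>] Con_trans[OF \<alpha>])
  moreover have "(eval B (case_sum b c) t, eval B (case_sum b d) t) \<in> \<beta>"
  proof (rule eval_Con[OF \<beta> _ t])
    show "(case_sum b c x, case_sum b d x) \<in> \<beta>" for x
      using ab cd Con_carrier(2)[OF \<alpha>] Con_refl[OF \<beta>] by (cases x) fastforce+
  qed
  ultimately show "(eval B (case_sum b c) t, eval B (case_sum b d) t) \<in> \<alpha> \<inter> \<beta>" by simp
qed

lemma centralizes_subset: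
  assumes \<alpha>: "\<alpha> \<in> Con ar B" and \<beta>: "\<beta> \<in> Con ar B" and \<delta>: "\<delta> \<in> Con ar B" and "\<alpha> \<subseteq> \<delta>"
  shows "centralizes ar B \<alpha> \<beta> \<delta>"
  unfolding centralizes_def
proof (intro allI impI)
  fix t :: "('b, nat + nat) term" and a b c d
  assume t: "wf_term ar t" and ab: "\<forall>i. (a i, b i) \<in> \<alpha>" and cd: "\<forall>j. (c j, d j) \<in> \<beta>"
    and ac: "(eval B (case_sum a c) t, eval B (case_sum a d) t) \<in> \<delta>"
  have "(eval B (case_sum a e) t, eval B (case_sum b e) t) \<in> \<delta>" if "range e \<subseteq> carrier B" for e
  proof (rule eval_Con[OF \<delta> _ t])
    show "(case_sum a e x, case_sum b e x) \<in> \<delta>" for x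
      using ab that assms(4) Con_refl[OF \<delta>] by (cases x) auto
  qed
  moreover have "range c \<subseteq> carrier B" "range d \<subseteq> carrier B" using cd Con_carrier[OF \<beta>] by blast+
  ultimately have "(eval B (case_sum a c) t, eval B (case_sum b c) t) \<in> \<delta>"
    "(eval B (case_sum a d) t, eval B (case_sum b d) t) \<in> \<delta>" by blast+
  then show "(eval B (case_sum b c) t, eval B (case_sum b d) t) \<in> \<delta>"
    using ac by (meson Con_sym[OF \<delta>] Con_trans[OF \<delta>])
qed

lemma centralizes_antimono:
  "centralizes ar B \<alpha> \<beta> \<delta> \<Longrightarrow> \<alpha>' \<subseteq> \<alpha> \<Longrightarrow> \<beta>' \<subseteq> \<beta> \<Longrightarrow> centralizes ar B \<alpha>' \<beta>' \<delta>"
  unfolding centralizes_def by blast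

lemma comm_Con: "algebra ar B \<Longrightarrow> comm ar B \<alpha> \<beta> \<in> Con ar B"
  unfolding comm_def by (rule Con_Nabla_Inter) auto

lemma comm_least: "\<delta> \<in> Con ar B \<Longrightarrow> centralizes ar B \<alpha> \<beta> \<delta> \<Longrightarrow> comm ar B \<alpha> \<beta> \<subseteq> \<delta>"
  unfolding comm_def by blast

text \<open>Saturation is inherited by intersections, so the commutator is itself one of the
  congruences over which it is formed.\<close>

lemma centralizes_comm:
  fixes B :: "('a, 'f) alg"
  assumes B: "algebra ar B" and \<alpha>: "\<alpha> \<in> Con ar B" and \<beta>: "\<beta> \<in> Con ar B"
  shows "centralizes ar B \<alpha> \<beta> (comm ar B \<alpha> \<beta>)"
proof -
  have "centralizes ar B \<alpha> \<beta> (Nabla B)"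
    using centralizes_subset[OF \<alpha> \<beta> Con_Nabla[OF B] Con_subset[OF \<alpha>]] .
  then show ?thesis
    unfolding centralizes_iff_saturated[OF B \<alpha> \<beta>] comm_def by fast
qed

lemma comm_subset_Int:
  assumes "algebra ar B" "\<alpha> \<in> Con ar B" "\<beta> \<in> Con ar B"
  shows "comm ar B \<alpha> \<beta> \<subseteq> \<alpha> \<inter> \<beta>"
  using assms by (intro comm_least centralizes_Int Con_Int)

text \<open>The trace \<open>?E\<close> of the join of the two \<open>diag_con\<close> congruences
  on the diagonal is a congruence above \<alpha> and \<open>\<alpha>'\<close>. Hence the
  \<open>diag_con\<close> of their join lies below \<open>?J\<close>, and saturation follows along
  the chains that make up \<open>?J\<close>.\<close>

lemma centralizes_join:
  assumes B: "algebra ar B" and \<alpha>: "\<alpha> \<in> Con ar B" and \<alpha>': "\<alpha>' \<in> Con ar B" and \<beta>: "\<beta> \<in> Con ar B"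
    and C: "centralizes ar B \<alpha> \<beta> \<delta>" "centralizes ar B \<alpha>' \<beta> \<delta>"
  shows "centralizes ar B (join ar B \<alpha> \<alpha>') \<beta> \<delta>"
proof -
  let ?P = "pair_alg B \<beta>" and ?D = "diag_con ar B \<beta>"
  let ?J = "join ar ?P (?D \<alpha>) (?D \<alpha>')"
  note P = pair_alg_algebra[OF B \<beta>] and D = diag_con_Con[OF B \<beta>]
  note J = join_Con[OF P, of "?D \<alpha>" "?D \<alpha>'"]
  let ?E = "{(x, y) \<in> Nabla B. ((x, x), (y, y)) \<in> ?J}"
  have E: "?E \<in> Con ar B"
  proof (rule ConI)
    show "(x, x) \<in> ?E" if "x \<in> carrier B" for x
      using that Con_refl[OF J, of "(x, x)"] Con_refl[OF \<beta>] by (auto simp: Nabla_def)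
    show "(y, x) \<in> ?E" if "(x, y) \<in> ?E" for x y
      using that Con_sym[OF J] by (auto simp: Nabla_def)
    show "(x, z) \<in> ?E" if "(x, y) \<in> ?E" "(y, z) \<in> ?E" for x y z
      using that Con_trans[OF J, of "(x, x)" "(y, y)"] by (auto simp: Nabla_def)
    fix f xs ys
    assume len: "length xs = ar f" and l: "list_all2 (\<lambda>x y. (x, y) \<in> ?E) xs ys"
    have car: "set xs \<subseteq> carrier B \<and> set ys \<subseteq> carrier B" by (rule list_all2_NablaD[OF l]) auto
    have len': "length ys = ar f" using list_all2_lengthD[OF l] len by simp
    have "(ops ?P f (map (\<lambda>x. (x, x)) xs), ops ?P f (map (\<lambda>x. (x, x)) ys)) \<in> ?J"
      using l len by (intro Con_ops[OF J]) (auto simp: list_all2_conv_all_nth)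
    then show "(ops B f xs, ops B f ys) \<in> ?E"
      using car len len' algebra_ops[OF B] by (simp add: comp_def Nabla_def)
  qed auto
  have "\<alpha> \<subseteq> ?E" "\<alpha>' \<subseteq> ?E"
    using diag_con_diag[OF \<beta> \<alpha>] diag_con_diag[OF \<beta> \<alpha>'] join_upper1[OF D D] join_upper2[OF D D]
      Con_subset[OF \<alpha>] Con_subset[OF \<alpha>'] by blast+
  from join_least[OF E this] have "?D (join ar B \<alpha> \<alpha>') \<subseteq> ?J"
    unfolding diag_con_def[of ar B \<beta> "join ar B \<alpha> \<alpha>'"] by (intro Cg_least[OF J]) auto
  moreover have "q \<in> \<delta>" if pq: "(p, q) \<in> ?J" and p: "p \<in> \<delta>" for p q
  proof (rule join_induct[OF P D[of \<alpha>] D[of \<alpha>'] pq, of "\<lambda>p. p \<in> \<delta>"])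
    show "v \<in> \<delta>" if "u \<in> \<delta>" "(u, v) \<in> ?D \<alpha> \<or> (u, v) \<in> ?D \<alpha>'" for u v
      using that C unfolding centralizes_iff_saturated[OF B \<alpha> \<beta>] centralizes_iff_saturated[OF B \<alpha>' \<beta>]
      by fast
  qed (rule p)
  ultimately show ?thesis
    unfolding centralizes_iff_saturated[OF B join_Con[OF B] \<beta>] by fast
qed

lemma prime_comm: "prime_con ar B \<phi> \<Longrightarrow> \<alpha> \<in> Con ar B \<Longrightarrow> \<beta> \<in> Con ar B \<Longrightarrow> comm ar B \<alpha> \<beta> \<subseteq> \<phi>
    \<Longrightarrow> \<alpha> \<subseteq> \<phi> \<or> \<beta> \<subseteq> \<phi>"
  by (auto simp: prime_con_def)

lemma prime_Int:
  assumes "algebra ar B" "prime_con ar B \<phi>" "\<alpha> \<in> Con ar B" "\<beta> \<in> Con ar B" "\<alpha> \<inter> \<beta> \<subseteq> \<phi>"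
  shows "\<alpha> \<subseteq> \<phi> \<or> \<beta> \<subseteq> \<phi>"
  using assms comm_subset_Int[OF assms(1,3,4)] by (intro prime_comm) auto

lemma rho_Con: "algebra ar B \<Longrightarrow> rho ar B \<theta> \<in> Con ar B"
  unfolding rho_def by (rule Con_Nabla_Inter) (auto simp: prime_con_def)

lemma rho_upper: "\<theta> \<in> Con ar B \<Longrightarrow> \<theta> \<subseteq> rho ar B \<theta>"
  using Con_subset[of \<theta> ar B] by (auto simp: rho_def)

lemma rho_subset_prime: "prime_con ar B \<phi> \<Longrightarrow> \<theta> \<subseteq> \<phi> \<Longrightarrow> rho ar B \<theta> \<subseteq> \<phi>"
  by (auto simp: rho_def)

section \<open>Embedding pair algebras\<close>

text \<open>The successor is needed only at \<open>n = 3\<close>, where 9 exceeds 8. It is paid for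
  below by the one pair that a proper subset omits.\<close>

lemma square_le_power2: "n\<^sup>2 \<le> Suc (2 ^ n)"
proof -
  consider "n = 0" | "n = 1" | "n = 2" | "n = 3" | "n \<ge> 4" by linarith
  then show ?thesis
  proof cases
    case 5
    then have "n\<^sup>2 \<le> 2 ^ n"
    proof (induction n rule: dec_induct)
      case (step n)
      have "Suc (n + n) \<le> 4 * n" using step by simp
      also have "\<dots> \<le> n * n" using step by simp
      finally have "(Suc n)\<^sup>2 \<le> 2 * n\<^sup>2" unfolding power2_eq_square by simp
      with step show ?case by simp
    qed simp
    then show ?thesis by simp
  qed auto
qed

text \<open>For finite types this is a count. For infinite ones the square injects into
  \<open>'a\<close>, and singletons lead on into \<open>'a set\<close>.\<close>

lemma proper_pair_set_embeds:
  fixes S :: "('a \<times> 'a) set"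
  assumes "S \<noteq> UNIV"
  obtains e :: "'a \<times> 'a \<Rightarrow> 'a set" where "inj_on e S"
proof (cases "finite (UNIV :: 'a set)")
  case True
  then have fin: "finite (UNIV :: ('a \<times> 'a) set)" "finite (UNIV :: 'a set set)"
    by (simp_all add: finite_prod Finite_Set.finite_set)
  have "card S < card (UNIV :: ('a \<times> 'a) set)"
    using assms fin by (intro psubset_card_mono) auto
  also have "\<dots> = (card (UNIV :: 'a set))\<^sup>2"
    by (simp add: card_cartesian_product power2_eq_square flip: UNIV_Times_UNIV)
  also have "\<dots> \<le> Suc (2 ^ card (UNIV :: 'a set))" by (rule square_le_power2)
  also have "2 ^ card (UNIV :: 'a set) = card (UNIV :: 'a set set)"
    using card_Pow[OF True] by simp
  finally have "card S \<le> card (UNIV :: 'a set set)" by simp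
  then obtain e :: "'a \<times> 'a \<Rightarrow> 'a set" where "inj_on e S"
    using card_le_inj[OF finite_subset[OF subset_UNIV fin(1)] fin(2)] by blast
  then show ?thesis by (rule that)
next
  case False
  then have "(card_of (UNIV \<times> UNIV :: ('a \<times> 'a) set), card_of (UNIV :: 'a set)) \<in> ordLeq"
    using card_of_Times_same_infinite ordIso_imp_ordLeq by blast
  then obtain g :: "'a \<times> 'a \<Rightarrow> 'a" where g: "inj_on g (UNIV \<times> UNIV)"
    unfolding card_of_ordLeq[symmetric] by (elim exE conjE)
  have "inj_on (\<lambda>p. {g p}) S"
  proof (rule inj_onI)
    fix p q assume "{g p} = {g q}"
    then have "g p = g q" by simp
    from inj_onD[OF g this] show "p = q" by simp
  qed
  then show ?thesis by (rule that)
qed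

section \<open>Semidegeneracy and the compactness of the top congruence\<close>

locale semidegenerate_modular =
  fixes ar :: "'f \<Rightarrow> nat"
    and Eqs :: "(('f, nat) term \<times> ('f, nat) term) set"
    and A :: "('a, 'f) alg"
  assumes finite_sig: "finite (UNIV :: 'f set)"
    and wf_Eqs: "\<forall>(s, t)\<in>Eqs. wf_term ar s \<and> wf_term ar t"
    and standing_aset: "\<forall>B :: ('a set, 'f) alg. standing ar Eqs B"
    and A_in_V: "inV ar Eqs A"
begin

abbreviation "CA \<equiv> Con ar A"

lemma alg: "algebra ar A"
  using A_in_V by (simp add: inV_def)

text \<open>The point of entry for the standing assumptions: they reach an algebra of the variety
  through its images on \<open>'a set\<close>.\<close>

lemma image_standing:
  assumes "inV ar Eqs B" and "surhom ar h B (C :: ('a set, 'f) alg)"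
  shows "modular_Con ar C" "no_trivial_subalg ar C" "ret_preserves_bool ar C"
  using standing_aset surhom_inV[OF wf_Eqs assms] by (auto simp: standing_def)

text \<open>The function \<open>h\<close> names the classes of \<theta> by elements of
  \<open>'a set\<close>. In the algebra so obtained \<open>h x\<close> is a one-element subalgebra,
  so semidegeneracy makes that algebra trivial.\<close>

lemma no_trivial_quotient:
  assumes B: "inV ar Eqs (B :: ('b, 'f) alg)" and \<theta>: "\<theta> \<in> Con ar B"
    and ker: "\<And>x y. x \<in> carrier B \<Longrightarrow> y \<in> carrier B \<Longrightarrow> h x = (h y :: 'a set) \<longleftrightarrow> (x, y) \<in> \<theta>"
    and x: "x \<in> carrier B" and idem: "\<And>f. (ops B f (replicate (ar f) x), x) \<in> \<theta>"
  shows "\<theta> = Nabla B"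
proof
  show "\<theta> \<subseteq> Nabla B" by (rule Con_subset[OF \<theta>])
  have alg: "algebra ar B" using B by (simp add: inV_def)
  obtain C where h: "surhom ar h B C" by (rule surhom_exists[OF alg \<theta> ker])
  have "ops C f (replicate (ar f) (h x)) = h x" for f
  proof -
    have "ops C f (map h (replicate (ar f) x)) = h (ops B f (replicate (ar f) x))"
      using x by (intro surhom_ops[OF h]) auto
    also have "\<dots> = h x" using ker Con_carrier[OF \<theta> idem] idem x by blast
    finally show ?thesis by simp
  qed
  then have "\<forall>u\<in>carrier C. \<forall>v\<in>carrier C. u = v"
    using image_standing(2)[OF B h] x surhom_carrier[OF h] unfolding no_trivial_subalg_def by blast
  then have "h u = h v" if "u \<in> carrier B" "v \<in> carrier B" for u v
    using that surhom_carrier[OF h] by blast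
  then show "Nabla B \<subseteq> \<theta>" unfolding Nabla_def using ker by blast
qed

text \<open>Identifying an element \<open>x\<close> with all \<open>f(x, \<dots>, x)\<close>, finitely many conditions, creates a
one-element subalgebra.\<close>

lemma Nabla_finitely_generated:
  obtains R where "finite R" "R \<subseteq> Nabla A" "Cg ar A R = Nabla A"
proof -
  obtain x where x: "x \<in> carrier A" using alg by (auto simp: algebra_def)
  let ?R = "range (\<lambda>f. (ops A f (replicate (ar f) x), x))"
  have R: "?R \<subseteq> Nabla A" using x by (auto simp: Nabla_def intro!: algebra_ops[OF alg])
  have \<theta>: "Cg ar A ?R \<in> CA" by (rule Cg_Con[OF alg])
  have "Cg ar A ?R = Nabla A"
  proof (rule no_trivial_quotient[OF A_in_V \<theta> _ x])
    show "Cg ar A ?R `` {y} = Cg ar A ?R `` {z} \<longleftrightarrow> (y, z) \<in> Cg ar A ?R"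
      if "y \<in> carrier A" "z \<in> carrier A" for y z
      using eq_equiv_class_iff[of "carrier A"] that \<theta> by (simp add: Con_def)
    show "(ops A f (replicate (ar f) x), x) \<in> Cg ar A ?R" for f
      using Cg_upper[OF R] by blast
  qed
  then show ?thesis using that R finite_sig by blast
qed

text \<open>The shifting lemma inside the pair algebra. Properness of \<beta> is what allows the
  pair algebra to be copied to \<open>'a set\<close>.\<close>

lemma pair_shift:
  assumes \<beta>: "\<beta> \<in> CA" "\<beta> \<noteq> Nabla A"
    and con: "\<alpha> \<in> Con ar (pair_alg A \<beta>)" "\<psi> \<in> Con ar (pair_alg A \<beta>)" "\<gamma> \<in> Con ar (pair_alg A \<beta>)"
    and "\<alpha> \<inter> \<psi> \<subseteq> \<gamma>"
    and "(x, y) \<in> \<alpha>" "(z, u) \<in> \<alpha>" "(x, z) \<in> \<psi>" "(y, u) \<in> \<psi>" "(z, u) \<in> \<gamma>"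
  shows "(x, y) \<in> \<gamma>"
proof -
  have "\<beta> \<noteq> UNIV" using \<beta>(2) Con_subset[OF \<beta>(1)] by blast
  then obtain e :: "'a \<times> 'a \<Rightarrow> 'a set" where e: "inj_on e \<beta>" by (rule proper_pair_set_embeds)
  let ?P = "pair_alg A \<beta>"
  note P = pair_alg_inV[OF A_in_V \<beta>(1)] pair_alg_algebra[OF alg \<beta>(1)]
  obtain C where h: "surhom ar e ?P C"
    by (rule surhom_exists[OF P(2) Con_Delta[OF P(2)], where h = e])
       (use e in \<open>auto simp: Delta_def dest: inj_onD\<close>)
  from e have "inj_on e (carrier ?P)" by simp
  from surhom_shift[OF P(2) h this image_standing(1)[OF P(1) h] con assms(6-)] show ?thesis .
qed

lemma centralizes_Nabla:
  assumes \<beta>: "\<beta> \<in> CA" and \<delta>: "\<delta> \<in> CA" and C: "centralizes ar A (Nabla A) \<beta> \<delta>"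
  shows "\<beta> \<subseteq> \<delta>"
proof (cases "\<exists>x y. x \<in> carrier A \<and> y \<in> carrier A \<and> x \<noteq> y")
  case False
  then have "Nabla A \<subseteq> \<delta>" using Con_refl[OF \<delta>] by (force simp: Nabla_def)
  then show ?thesis using Con_subset[OF \<beta>] by blast
next
  case True
  then obtain x y where xy: "x \<in> carrier A" "y \<in> carrier A" "x \<noteq> y" by blast
  let ?P = "pair_alg A \<beta>" and ?D = "diag_con ar A \<beta> (Nabla A)"
  note N = Con_Nabla[OF alg]
  note D = diag_con_Con[OF alg \<beta>, of "Nabla A"]
  note diag = diag_con_diag[OF \<beta> N]
  note P = pair_alg_inV[OF A_in_V \<beta>]
  \<comment> \<open>The representative depends only on the class of \<open>p\<close>, so
    \<open>r\<close> followed by an injective code names the quotient of the pair algebra; the pair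
    algebra itself need not be coded. This keeps \<beta> = \<nabla> within reach.\<close>
  define r where "r p = (SOME q. (p, q) \<in> ?D)" for p
  have r: "(p, r p) \<in> ?D" if "p \<in> \<beta>" for p
    unfolding r_def by (rule someI[of _ p]) (use Con_refl[OF D] that in simp)
  have r_eq: "r p = r q \<longleftrightarrow> (p, q) \<in> ?D" if "p \<in> \<beta>" "q \<in> \<beta>" for p q
  proof
    show "(p, q) \<in> ?D" if "r p = r q"
      using r[OF \<open>p \<in> \<beta>\<close>] r[OF \<open>q \<in> \<beta>\<close>] that Con_sym[OF D] Con_trans[OF D] by metis
    show "r p = r q" if "(p, q) \<in> ?D"
      using that Con_sym[OF D] Con_trans[OF D] unfolding r_def by metis
  qed
  text \<open>Since \<open>(x, x)\<close> and \<open>(y, y)\<close> share a class, the representatives are a proper subset.\<close>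
  have "r ` \<beta> \<noteq> UNIV"
  proof
    assume "r ` \<beta> = UNIV"
    then obtain p q where pq: "p \<in> \<beta>" "q \<in> \<beta>" "r p = (x, x)" "r q = (y, y)" by (metis UNIV_I imageE)
    have "((x, x), (y, y)) \<in> ?D" using diag xy by (simp add: Nabla_def)
    then have "(p, q) \<in> ?D"
      using r[OF pq(1)] r[OF pq(2)] pq(3,4) Con_sym[OF D] Con_trans[OF D] by metis
    then show False using r_eq[OF pq(1,2)] pq(3,4) xy(3) by simp
  qed
  then obtain e :: "'a \<times> 'a \<Rightarrow> 'a set" where e: "inj_on e (r ` \<beta>)" by (rule proper_pair_set_embeds)
  have "?D = Nabla ?P"
  proof (rule no_trivial_quotient[OF P D, where h = "e \<circ> r" and x = "(x, x)"])
    show "(e \<circ> r) p = (e \<circ> r) q \<longleftrightarrow> (p, q) \<in> ?D" if "p \<in> carrier ?P" "q \<in> carrier ?P" for p q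
      using that r_eq inj_on_eq_iff[OF e] by simp
    show "(x, x) \<in> carrier ?P" using xy Con_refl[OF \<beta>] by simp
    show "(ops ?P f (replicate (ar f) (x, x)), (x, x)) \<in> ?D" for f
    proof -
      have "(ops A f (replicate (ar f) x), x) \<in> Nabla A"
        unfolding Nabla_def using xy by (auto intro!: algebra_ops[OF alg])
      from diag[OF this] show ?thesis by simp
    qed
  qed
  \<comment> \<open>Saturation starts from \<open>(x, x)\<close>, which lies in \<delta> by
    reflexivity, and so reaches every pair of \<beta>.\<close>
  then have "((x, x), p) \<in> ?D" if "p \<in> \<beta>" for p using that Con_refl[OF \<beta>] xy by simp
  then show ?thesis
    using C Con_refl[OF \<delta> xy(1)] unfolding centralizes_iff_saturated[OF alg N \<beta>] by fast
qed

lemma coordinate_Con: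
  assumes \<beta>: "\<beta> \<in> CA" and \<phi>: "\<phi> \<in> CA"
  shows "pull fst (pair_alg A \<beta>) \<phi> \<in> Con ar (pair_alg A \<beta>)"
    and "pull snd (pair_alg A \<beta>) \<phi> \<in> Con ar (pair_alg A \<beta>)"
proof -
  have "fst ` \<beta> = carrier A" "snd ` \<beta> = carrier A"
    using Con_subset[OF \<beta>] Con_refl[OF \<beta>] by (force simp: Nabla_def)+
  then have "surhom ar fst (pair_alg A \<beta>) A" "surhom ar snd (pair_alg A \<beta>) A"
    by (simp_all add: surhom_def)
  then show "pull fst (pair_alg A \<beta>) \<phi> \<in> Con ar (pair_alg A \<beta>)"
    and "pull snd (pair_alg A \<beta>) \<phi> \<in> Con ar (pair_alg A \<beta>)"
    using pull_Con[OF pair_alg_algebra[OF alg \<beta>] _ \<phi>] by blast+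
qed

text \<open>The generators lie in the preimages of \<alpha> under both projections, and these are
  congruences.\<close>

lemma diag_con_coordinates:
  assumes \<alpha>: "\<alpha> \<in> CA" and \<beta>: "\<beta> \<in> CA" and D: "((x, y), (z, u)) \<in> diag_con ar A \<beta> \<alpha>"
  shows "(x, z) \<in> \<alpha>" "(y, u) \<in> \<alpha>"
proof -
  let ?P = "pair_alg A \<beta>"
  have diag: "{((x, x), (y, y)) | x y. (x, y) \<in> \<alpha>} \<subseteq> pull h ?P \<alpha>" if "\<And>x. h (x, x) = x" for h
    using that Con_carrier[OF \<alpha>] Con_refl[OF \<beta>] by (auto simp: pull_def)
  have "diag_con ar A \<beta> \<alpha> \<subseteq> pull fst ?P \<alpha>" "diag_con ar A \<beta> \<alpha> \<subseteq> pull snd ?P \<alpha>"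
    unfolding diag_con_def
    using Cg_least[OF coordinate_Con(1)[OF \<beta> \<alpha>] diag] Cg_least[OF coordinate_Con(2)[OF \<beta> \<alpha>] diag]
    by simp_all
  then show "(x, z) \<in> \<alpha>" "(y, u) \<in> \<alpha>" using D by (auto simp: pull_def)
qed

section \<open>Persistence and symmetry of the term condition\<close>

context
  fixes \<alpha> \<beta> \<delta>
  assumes \<alpha>: "\<alpha> \<in> CA" and \<beta>: "\<beta> \<in> CA" "\<beta> \<noteq> Nabla A" and \<delta>: "\<delta> \<in> CA"
    and C: "centralizes ar A \<alpha> \<beta> \<delta>"
begin

text \<open>The shifting lemma, applied to the kernels of the two projections, moves the common
  second coordinate from \<open>w\<close> to \<open>y\<close>. Then \<open>(x, y)\<close> is related
  to \<open>(y, y)\<close>, and saturation gives the claim because \<open>(y, y)\<close> lies in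
  \<delta>.\<close>

lemma diag_con_snd:
  assumes "((x, w), (y, w)) \<in> diag_con ar A \<beta> \<alpha>"
  shows "(x, y) \<in> \<delta>"
proof -
  let ?P = "pair_alg A \<beta>" and ?D = "diag_con ar A \<beta> \<alpha>"
  note D = diag_con_Con[OF alg \<beta>(1), of \<alpha>]
  note \<eta> = coordinate_Con[OF \<beta>(1) Con_Delta[OF alg]]
  have w: "(x, w) \<in> \<beta>" "(y, w) \<in> \<beta>" using assms Con_carrier[OF D] by auto
  then have xy: "(x, y) \<in> \<beta>" "(y, y) \<in> \<beta>"
    using Con_sym[OF \<beta>(1)] Con_trans[OF \<beta>(1)] by blast+
  have car: "x \<in> carrier A" "y \<in> carrier A" "w \<in> carrier A" using w Con_carrier[OF \<beta>(1)] by auto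
  have "((x, y), (y, y)) \<in> ?D"
  proof (rule pair_shift[OF \<beta> \<eta>(2) \<eta>(1) D])
    show "pull snd ?P (Delta A) \<inter> pull fst ?P (Delta A) \<subseteq> ?D"
      using Con_refl[OF D] by (auto simp: pull_def Delta_def)
    show "((x, w), (y, w)) \<in> ?D" by (rule assms)
  qed (use w xy car in \<open>auto simp: pull_def Delta_def\<close>)
  then have "((y, y), (x, y)) \<in> ?D" by (rule Con_sym[OF D])
  then show ?thesis
    using C Con_refl[OF \<delta> car(2)] unfolding centralizes_iff_saturated[OF alg \<alpha> \<beta>(1)] by fast
qed

text \<open>Each of the rows \<open>(x, y)\<close> and \<open>(z, u)\<close> is compared with the
  diagonal pair having the same second coordinate. Shifting with \<open>diag_con\<close> as the side
  relation carries \<open>\<delta>'\<close> from first coordinates \<open>x\<close>,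
  \<open>y\<close> to \<open>z\<close>, \<open>u\<close>; \<open>diag_con_snd\<close> supplies the
  required inclusion in \<delta>, hence in \<open>\<delta>'\<close>.\<close>

lemma centralizes_mono:
  assumes \<delta>': "\<delta>' \<in> CA" "\<delta> \<subseteq> \<delta>'"
  shows "centralizes ar A \<alpha> \<beta> \<delta>'"
proof -
  let ?P = "pair_alg A \<beta>" and ?D = "diag_con ar A \<beta> \<alpha>"
  note D = diag_con_Con[OF alg \<beta>(1), of \<alpha>]
  have "(z, u) \<in> \<delta>'" if xyzu: "((x, y), (z, u)) \<in> ?D" and xy: "(x, y) \<in> \<delta>'" for x y z u
  proof -
    have \<beta>': "(x, y) \<in> \<beta>" "(z, u) \<in> \<beta>" using xyzu Con_carrier[OF D] by auto
    then have car: "x \<in> carrier A" "y \<in> carrier A" "z \<in> carrier A" "u \<in> carrier A"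
      using Con_carrier[OF \<beta>(1)] by auto
    have "((y, y), (u, u)) \<in> ?D"
      using diag_con_diag[OF \<beta>(1) \<alpha>] diag_con_coordinates[OF \<alpha> \<beta>(1) xyzu] by blast
    then have "((u, u), (y, y)) \<in> ?D" by (rule Con_sym[OF D])
    have "((z, u), (u, u)) \<in> pull fst ?P \<delta>'"
    proof (rule pair_shift[OF \<beta> coordinate_Con(2)[OF \<beta>(1) Con_Delta[OF alg]] D coordinate_Con(1)[OF \<beta>(1) \<delta>'(1)],
          where z = "(x, y)" and u = "(y, y)"])
      show "pull snd ?P (Delta A) \<inter> ?D \<subseteq> pull fst ?P \<delta>'"
        using diag_con_snd \<delta>'(2) by (auto simp: pull_def Delta_def)
      show "((z, u), (x, y)) \<in> ?D" using xyzu by (rule Con_sym[OF D])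
      show "((u, u), (y, y)) \<in> ?D" by fact
    qed (use \<beta>' car xy Con_refl[OF \<beta>(1)] in \<open>auto simp: pull_def Delta_def\<close>)
    then show ?thesis by (simp add: pull_def)
  qed
  then show ?thesis unfolding centralizes_iff_saturated[OF alg \<alpha> \<beta>(1)] by fast
qed

text \<open>For the transposed matrix the rows are compared with the constant rows
  \<open>(x, x)\<close> and \<open>(z, z)\<close>, which share their first coordinates. Shifting
  carries \<delta> from the second coordinates \<open>x\<close>, \<open>z\<close> to
  \<open>y\<close>, \<open>u\<close>; the required inclusion is \<open>diag_con_snd\<close> with
  coordinates swapped.\<close>

lemma centralizes_sym: "centralizes ar A \<beta> \<alpha> \<delta>"
  unfolding centralizes_def
proof (intro allI impI)
  fix t :: "('f, nat + nat) term" and a b c d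
  assume t: "wf_term ar t" and ab: "\<forall>i. (a i, b i) \<in> \<beta>" and cd: "\<forall>j. (c j, d j) \<in> \<alpha>"
    and ac: "(eval A (case_sum a c) t, eval A (case_sum a d) t) \<in> \<delta>"
  let ?P = "pair_alg A \<beta>" and ?D = "diag_con ar A \<beta> \<alpha>"
  note D = diag_con_Con[OF alg \<beta>(1), of \<alpha>]
  \<comment> \<open>Exchanging the two kinds of variables transposes the matrix, which makes
    \<open>diag_con_matrix\<close> applicable.\<close>
  define s where "s = map_term id (case_sum Inr Inl) t"
  define x y z u where xyzu_def: "x = eval A (case_sum a c) t" "y = eval A (case_sum b c) t"
    "z = eval A (case_sum a d) t" "u = eval A (case_sum b d) t"
  have s: "eval A (case_sum e' e) s = eval A (case_sum e e') t" for e e' :: "nat \<Rightarrow> 'a"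
    unfolding s_def eval_map_term
    by (rule arg_cong[where f = "\<lambda>v. eval A v t"]) (auto simp: fun_eq_iff split: sum.split)
  have "wf_term ar s" using t by (simp add: s_def wf_map_term)
  from diag_con_matrix[OF alg \<alpha> \<beta>(1) this, of c d a b] ab cd
  have xyzu: "((x, y), (z, u)) \<in> ?D" by (simp add: s xyzu_def)
  then have \<beta>': "(x, y) \<in> \<beta>" "(z, u) \<in> \<beta>" using Con_carrier[OF D] by auto
  then have car: "x \<in> carrier A" "y \<in> carrier A" "z \<in> carrier A" "u \<in> carrier A"
    using Con_carrier[OF \<beta>(1)] by auto
  have "((x, y), (z, u)) \<in> pull snd ?P \<delta>"
  proof (rule pair_shift[OF \<beta> D coordinate_Con(1)[OF \<beta>(1) Con_Delta[OF alg]] coordinate_Con(2)[OF \<beta>(1) \<delta>],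
        where z = "(x, x)" and u = "(z, z)"])
    show "?D \<inter> pull fst ?P (Delta A) \<subseteq> pull snd ?P \<delta>"
      using diag_con_snd[OF diag_con_swap[OF alg \<alpha> \<beta>(1)]] Con_carrier[OF D]
      by (auto simp: pull_def Delta_def)
    show "((x, y), (z, u)) \<in> ?D" by (rule xyzu)
    show "((x, x), (z, z)) \<in> ?D"
      using diag_con_diag[OF \<beta>(1) \<alpha>] diag_con_coordinates[OF \<alpha> \<beta>(1) xyzu] by blast
  qed (use \<beta>' car ac Con_refl[OF \<beta>(1)] in \<open>auto simp: pull_def Delta_def xyzu_def\<close>)
  then show "(eval A (case_sum b c) t, eval A (case_sum b d) t) \<in> \<delta>"
    by (simp add: pull_def xyzu_def)
qed

end

section \<open>Existence of primes and comparison of congruences\<close>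

text \<open>Persistence lets the commutator be replaced by the term condition modulo \<phi> itself,
  at the price of a proper second argument; the cases with \<nabla> are settled separately.\<close>

lemma primeI:
  assumes \<phi>: "\<phi> \<in> CA" "\<phi> \<noteq> Nabla A"
    and step: "\<And>\<alpha> \<beta>. \<alpha> \<in> CA \<Longrightarrow> \<beta> \<in> CA \<Longrightarrow> \<alpha> \<noteq> Nabla A \<Longrightarrow> \<beta> \<noteq> Nabla A
      \<Longrightarrow> centralizes ar A \<alpha> \<beta> \<phi> \<Longrightarrow> \<alpha> \<subseteq> \<phi> \<or> \<beta> \<subseteq> \<phi>"
  shows "prime_con ar A \<phi>"
  unfolding prime_con_def
proof (intro conjI ballI impI \<phi>)
  fix \<alpha> \<beta>
  assume \<alpha>: "\<alpha> \<in> CA" and \<beta>: "\<beta> \<in> CA" and le: "comm ar A \<alpha> \<beta> \<subseteq> \<phi>"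
  note C = centralizes_comm[OF alg \<alpha> \<beta>] and comm = comm_Con[OF alg, of \<alpha> \<beta>]
  consider "\<alpha> = Nabla A" | "\<alpha> \<noteq> Nabla A" "\<beta> = Nabla A" | "\<alpha> \<noteq> Nabla A" "\<beta> \<noteq> Nabla A" by blast
  then show "\<alpha> \<subseteq> \<phi> \<or> \<beta> \<subseteq> \<phi>"
  proof cases
    case 1
    then show ?thesis using centralizes_Nabla[OF \<beta> comm] C le by blast
  next
    case 2
    \<comment> \<open>Shrinking the second argument from \<nabla> to \<alpha> makes it proper, and
      \<open>step\<close> for \<alpha> with itself suffices.\<close>
    have "centralizes ar A \<alpha> \<alpha> (comm ar A \<alpha> \<beta>)"
      using C by (rule centralizes_antimono) (use 2 Con_subset[OF \<alpha>] in auto)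
    from centralizes_mono[OF \<alpha> \<alpha> 2(1) comm this \<phi>(1) le] show ?thesis
      using step[OF \<alpha> \<alpha> 2(1) 2(1)] by blast
  next
    case 3
    from centralizes_mono[OF \<alpha> \<beta> 3(2) comm C \<phi>(1) le] show ?thesis
      using step[OF \<alpha> \<beta> 3] by blast
  qed
qed

lemma join_Nabla: "\<alpha> \<in> CA \<Longrightarrow> \<beta> \<in> CA \<Longrightarrow> \<gamma> \<in> CA \<Longrightarrow> join ar A \<alpha> \<beta> = Nabla A
    \<Longrightarrow> \<alpha> \<subseteq> \<gamma> \<Longrightarrow> \<beta> \<subseteq> \<gamma> \<Longrightarrow> \<gamma> = Nabla A"
  using join_least[of \<gamma> ar A \<alpha> \<beta>] Con_subset[of \<gamma> ar A] by auto

text \<open>Since \<nabla> is finitely generated, Zorn's lemma gives a maximal proper congruence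
  \<open>M\<close> above \<tau>. If \<alpha> is not below \<open>M\<close>, then the join \<nabla>
  of \<alpha> and \<open>M\<close> still centralizes \<beta> modulo \<open>M\<close>, which forces
  \<beta> below \<open>M\<close>.\<close>

lemma prime_above:
  assumes \<tau>: "\<tau> \<in> CA" "\<tau> \<noteq> Nabla A"
  obtains \<phi> where "prime_con ar A \<phi>" "\<tau> \<subseteq> \<phi>"
proof -
  obtain R where R: "finite R" "R \<subseteq> Nabla A" "Cg ar A R = Nabla A"
    by (rule Nabla_finitely_generated)
  let ?S = "{X \<in> CA. \<tau> \<subseteq> X \<and> X \<noteq> Nabla A}"
  have "\<exists>M\<in>?S. \<forall>X\<in>?S. M \<subseteq> X \<longrightarrow> X = M"
  proof (rule subset_Zorn_nonempty)
    show "?S \<noteq> {}" using \<tau> by blast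
    fix \<C> assume \<C>: "\<C> \<noteq> {}" and chain: "subset.chain ?S \<C>"
    have sub: "\<C> \<subseteq> ?S" using chain by (simp add: subset.chain_def)
    have "\<Union>\<C> \<in> CA"
    proof (rule Con_directed_Union[OF alg _ \<C>])
      show "\<C> \<subseteq> CA" using sub by blast
      show "\<exists>Z\<in>\<C>. X \<union> Y \<subseteq> Z" if "X \<in> \<C>" "Y \<in> \<C>" for X Y
      proof -
        have "X \<subseteq> Y \<or> Y \<subseteq> X" using chain that by (auto simp: subset_chain_def)
        then show ?thesis using that by blast
      qed
    qed
    moreover have "\<tau> \<subseteq> \<Union>\<C>" using \<C> sub by blast
    moreover have "\<Union>\<C> \<noteq> Nabla A"
    proof
      assume eq: "\<Union>\<C> = Nabla A"
      obtain X where X: "X \<in> \<C>" "R \<subseteq> X"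
        using finite_subset_Union_chain[OF R(1) _ \<C> chain] R(2) eq by metis
      then have "X \<in> CA" "X \<noteq> Nabla A" using sub by auto
      with Cg_least[of X ar A R] R(3) X(2) Con_subset[of X ar A] show False by auto
    qed
    ultimately show "\<Union>\<C> \<in> ?S" by blast
  qed
  then obtain M where M: "M \<in> CA" "\<tau> \<subseteq> M" "M \<noteq> Nabla A"
    and max: "\<And>X. X \<in> CA \<Longrightarrow> M \<subseteq> X \<Longrightarrow> X \<noteq> Nabla A \<Longrightarrow> X = M"
    by (auto dest: order_trans)
  have "prime_con ar A M"
  proof (rule primeI[OF M(1,3)])
    fix \<alpha> \<beta>
    assume \<alpha>: "\<alpha> \<in> CA" and \<beta>: "\<beta> \<in> CA" and C: "centralizes ar A \<alpha> \<beta> M"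
    show "\<alpha> \<subseteq> M \<or> \<beta> \<subseteq> M"
    proof (cases "\<alpha> \<subseteq> M")
      case False
      then have "join ar A \<alpha> M \<noteq> M" using join_upper1[OF \<alpha> M(1)] by blast
      then have "join ar A \<alpha> M = Nabla A"
        using max[OF join_Con[OF alg] join_upper2[OF \<alpha> M(1)]] by blast
      moreover have "centralizes ar A (join ar A \<alpha> M) \<beta> M"
        by (intro centralizes_join centralizes_subset alg \<alpha> \<beta> M C order_refl)
      ultimately show ?thesis using centralizes_Nabla[OF \<beta> M(1)] by simp
    qed simp
  qed
  then show ?thesis using M(2) by (rule that)
qed

lemma eq_NablaI:
  assumes "\<tau> \<in> CA" and "\<And>\<phi>. prime_con ar A \<phi> \<Longrightarrow> \<tau> \<subseteq> \<phi> \<Longrightarrow> False"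
  shows "\<tau> = Nabla A"
  using assms prime_above[of \<tau>] by blast

text \<open>Here distributivity enters: \<open>\<chi> = [\<nabla>, \<chi>] = [\<psi>, \<chi>] \<or> [\<chi>', \<chi>] \<subseteq> \<psi>\<close>.\<close>

lemma subset_of_codisjoint:
  assumes \<psi>: "\<psi> \<in> CA" and \<chi>: "\<chi> \<in> CA" and \<chi>': "\<chi>' \<in> CA"
    and top: "join ar A \<psi> \<chi>' = Nabla A" and le: "\<chi> \<inter> \<chi>' \<subseteq> \<psi>"
  shows "\<chi> \<subseteq> \<psi>"
proof (cases "\<chi> = Nabla A")
  case True
  then have "\<chi>' \<subseteq> \<psi>" using le Con_subset[OF \<chi>'] by blast
  then have "\<psi> = Nabla A" using join_Nabla[OF \<psi> \<chi>' \<psi> top] by blast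
  then show ?thesis using Con_subset[OF \<chi>] by simp
next
  case False
  note \<delta> = Con_Int[OF alg \<psi> \<chi>]
  \<comment> \<open>The modulus is enlarged from \<open>\<chi>' \<inter> \<chi>\<close> by
    persistence, for which \<chi> has to be proper.\<close>
  have "centralizes ar A \<chi>' \<chi> (\<psi> \<inter> \<chi>)"
    by (rule centralizes_mono[OF \<chi>' \<chi> False Con_Int[OF alg \<chi>' \<chi>] centralizes_Int[OF \<chi>' \<chi>] \<delta>])
       (use le in blast)
  from centralizes_join[OF alg \<psi> \<chi>' \<chi> centralizes_Int[OF \<psi> \<chi>] this] top
  show ?thesis using centralizes_Nabla[OF \<chi> \<delta>] by simp
qed

section \<open>Quotients\<close>

context
  fixes \<theta> and h :: "'a \<Rightarrow> 'b" and Q :: "('b, 'f) alg"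
  assumes \<theta>: "\<theta> \<in> CA" and h: "surhom ar h A Q" and ker: "pull h A Id = \<theta>"
begin

lemma pull_above: "\<phi> \<in> Con ar Q \<Longrightarrow> \<theta> \<subseteq> pull h A \<phi>"
  using Con_refl[of \<phi> ar Q] surhom_carrier[OF h] by (auto simp: pull_def Nabla_def simp flip: ker)

lemma alg_Q: "algebra ar Q"
  by (rule surhom_algebra[OF alg h])

lemma push_pull_Q: "\<phi> \<in> Con ar Q \<Longrightarrow> push h (pull h A \<phi>) = \<phi>"
  using push_pull[OF h Con_subset] .

lemma pull_push_Q: "\<chi> \<in> CA \<Longrightarrow> \<theta> \<subseteq> \<chi> \<Longrightarrow> pull h A (push h \<chi>) = \<chi>"
  by (rule pull_push) (auto simp: ker)

lemma push_Con_Q: "\<chi> \<in> CA \<Longrightarrow> \<theta> \<subseteq> \<chi> \<Longrightarrow> push h \<chi> \<in> Con ar Q"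
  by (rule push_Con[OF alg h]) (auto simp: ker)

lemma pull_Nabla: "pull h A (Nabla Q) = Nabla A"
  using surhom_carrier[OF h] by (auto simp: pull_def Nabla_def)

lemma pull_Delta: "pull h A (Delta Q) = \<theta>"
  using surhom_carrier[OF h] by (auto simp: pull_def Nabla_def Delta_def simp flip: ker)

lemma pull_Int: "pull h A (\<phi> \<inter> \<psi>) = pull h A \<phi> \<inter> pull h A \<psi>"
  by (auto simp: pull_def)

lemma pull_subset_iff:
  assumes "\<phi> \<in> Con ar Q" "\<chi> \<in> CA" "\<theta> \<subseteq> \<chi>"
  shows "pull h A \<phi> \<subseteq> \<chi> \<longleftrightarrow> \<phi> \<subseteq> push h \<chi>"
  using push_mono[of "pull h A \<phi>" \<chi> h] pull_mono[of \<phi> "push h \<chi>" h A]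
    push_pull_Q[OF assms(1)] pull_push_Q[OF assms(2,3)] by auto

lemma push_subset_iff:
  assumes "\<phi> \<in> Con ar Q" "\<chi> \<in> CA" "\<theta> \<subseteq> \<chi>"
  shows "push h \<chi> \<subseteq> \<phi> \<longleftrightarrow> \<chi> \<subseteq> pull h A \<phi>"
  using push_mono[of \<chi> "pull h A \<phi>" h] pull_mono[of "push h \<chi>" \<phi> h A]
    push_pull_Q[OF assms(1)] pull_push_Q[OF assms(2,3)] by auto

lemma pull_inject:
  "\<phi> \<in> Con ar Q \<Longrightarrow> \<psi> \<in> Con ar Q \<Longrightarrow> pull h A \<phi> = pull h A \<psi> \<Longrightarrow> \<phi> = \<psi>"
  using push_pull_Q by metis

lemma pull_complement:
  assumes \<phi>: "\<phi> \<in> Con ar Q" and \<phi>': "\<phi>' \<in> Con ar Q"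
  shows "join ar A (pull h A \<phi>) (pull h A \<phi>') = Nabla A \<longleftrightarrow> join ar Q \<phi> \<phi>' = Nabla Q"
proof
  note p = pull_Con[OF alg h \<phi>] pull_Con[OF alg h \<phi>']
  note J = join_Con[OF alg, of "pull h A \<phi>" "pull h A \<phi>'"]
  note JQ = join_Con[OF alg_Q, of \<phi> \<phi>']
  have "pull h A \<phi> \<subseteq> pull h A (join ar Q \<phi> \<phi>')" "pull h A \<phi>' \<subseteq> pull h A (join ar Q \<phi> \<phi>')"
    using pull_mono join_upper1[OF \<phi> \<phi>'] join_upper2[OF \<phi> \<phi>'] by blast+
  then show "join ar Q \<phi> \<phi>' = Nabla Q" if "join ar A (pull h A \<phi>) (pull h A \<phi>') = Nabla A"
    using join_Nabla[OF p pull_Con[OF alg h JQ] that] pull_Nabla pull_inject[OF JQ Con_Nabla[OF alg_Q]]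
    by simp
  show "join ar A (pull h A \<phi>) (pull h A \<phi>') = Nabla A" if top: "join ar Q \<phi> \<phi>' = Nabla Q"
  proof -
    have above: "\<theta> \<subseteq> join ar A (pull h A \<phi>) (pull h A \<phi>')"
      using pull_above[OF \<phi>] join_upper1[OF p] by blast
    have "join ar Q \<phi> \<phi>' \<subseteq> push h (join ar A (pull h A \<phi>) (pull h A \<phi>'))"
      using join_upper1[OF p] join_upper2[OF p] pull_subset_iff[OF _ J above] \<phi> \<phi>'
      by (intro join_least push_Con_Q J above) auto
    then have "Nabla A \<subseteq> join ar A (pull h A \<phi>) (pull h A \<phi>')"
      using pull_subset_iff[OF Con_Nabla[OF alg_Q] J above] top pull_Nabla by simp
    then show ?thesis using Con_subset[OF J] by blast
  qed
qed

text \<open>A congruence \<open>\<chi>'\<close> meeting \<open>pull h A \<phi>\<close> in \<theta>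
  lies above \<theta>, hence comes from the quotient; complements there correspond to complements
  over \<theta>.\<close>

lemma BoolCon_Q:
  "\<phi> \<in> BoolCon ar Q \<longleftrightarrow> \<phi> \<in> Con ar Q \<and>
     (\<exists>\<chi>'\<in>CA. pull h A \<phi> \<inter> \<chi>' = \<theta> \<and> join ar A (pull h A \<phi>) \<chi>' = Nabla A)"
proof (cases "\<phi> \<in> Con ar Q")
  case \<phi>: True
  have "(\<exists>\<phi>'\<in>Con ar Q. \<phi> \<inter> \<phi>' = Delta Q \<and> join ar Q \<phi> \<phi>' = Nabla Q) \<longleftrightarrow>
     (\<exists>\<chi>'\<in>CA. pull h A \<phi> \<inter> \<chi>' = \<theta> \<and> join ar A (pull h A \<phi>) \<chi>' = Nabla A)"
  proof
    assume "\<exists>\<phi>'\<in>Con ar Q. \<phi> \<inter> \<phi>' = Delta Q \<and> join ar Q \<phi> \<phi>' = Nabla Q"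
    then obtain \<phi>' where \<phi>': "\<phi>' \<in> Con ar Q" "\<phi> \<inter> \<phi>' = Delta Q" "join ar Q \<phi> \<phi>' = Nabla Q" by blast
    then show "\<exists>\<chi>'\<in>CA. pull h A \<phi> \<inter> \<chi>' = \<theta> \<and> join ar A (pull h A \<phi>) \<chi>' = Nabla A"
      using pull_complement[OF \<phi> \<phi>'(1)] pull_Con[OF alg h \<phi>'(1)] pull_Delta
      by (intro bexI[of _ "pull h A \<phi>'"]) (auto simp flip: pull_Int)
  next
    assume "\<exists>\<chi>'\<in>CA. pull h A \<phi> \<inter> \<chi>' = \<theta> \<and> join ar A (pull h A \<phi>) \<chi>' = Nabla A"
    then obtain \<chi>' where \<chi>': "\<chi>' \<in> CA" "pull h A \<phi> \<inter> \<chi>' = \<theta>"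
      "join ar A (pull h A \<phi>) \<chi>' = Nabla A" by blast
    then have above: "\<theta> \<subseteq> \<chi>'" by blast
    note p = push_Con_Q[OF \<chi>'(1) above] pull_push_Q[OF \<chi>'(1) above]
    have "pull h A (\<phi> \<inter> push h \<chi>') = pull h A (Delta Q)"
      using \<chi>' p pull_Delta pull_Int by simp
    moreover have "\<phi> \<inter> push h \<chi>' \<subseteq> Nabla Q" "Delta Q \<subseteq> Nabla Q"
      using Con_subset[OF \<phi>] by (auto simp: Delta_def Nabla_def)
    ultimately have "\<phi> \<inter> push h \<chi>' = Delta Q" using push_pull[OF h] by metis
    then show "\<exists>\<phi>'\<in>Con ar Q. \<phi> \<inter> \<phi>' = Delta Q \<and> join ar Q \<phi> \<phi>' = Nabla Q"
      using p pull_complement[OF \<phi> p(1)] \<chi>'(3) by auto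
  qed
  then show ?thesis using \<phi> by (simp add: BoolCon_def)
qed (simp add: BoolCon_def)

section \<open>The term condition and primes under quotients\<close>

lemma eval_sum_Q:
  assumes t: "wf_term ar t" and "range e \<subseteq> carrier A" "range e' \<subseteq> carrier A"
  shows "eval Q (case_sum (h \<circ> e) (h \<circ> e')) t = h (eval A (case_sum e e') t)"
    and "eval A (case_sum e e') t \<in> carrier A"
proof -
  have "case_sum e e' x \<in> carrier A" for x using assms by (cases x) auto
  then have "range (case_sum e e') \<subseteq> carrier A" by blast
  from surhom_eval[OF alg h t this] eval_carrier[OF alg t this]
  show "eval Q (case_sum (h \<circ> e) (h \<circ> e')) t = h (eval A (case_sum e e') t)"
    "eval A (case_sum e e') t \<in> carrier A" by (simp_all only: o_case_sum)
qed

lemma centralizes_pull: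
  assumes "centralizes ar Q \<alpha> \<beta> \<delta>"
  shows "centralizes ar A (pull h A \<alpha>) (pull h A \<beta>) (pull h A \<delta>)"
  unfolding centralizes_def
proof (intro allI impI)
  fix t :: "('f, nat + nat) term" and a b c d
  assume t: "wf_term ar t" and ab: "\<forall>i. (a i, b i) \<in> pull h A \<alpha>" and cd: "\<forall>j. (c j, d j) \<in> pull h A \<beta>"
    and ac: "(eval A (case_sum a c) t, eval A (case_sum a d) t) \<in> pull h A \<delta>"
  note ev = eval_sum_Q[OF t]
  have car: "range a \<subseteq> carrier A" "range b \<subseteq> carrier A" "range c \<subseteq> carrier A" "range d \<subseteq> carrier A"
    using ab cd by (auto simp: pull_def Nabla_def)
  have "(eval Q (case_sum (h \<circ> b) (h \<circ> c)) t, eval Q (case_sum (h \<circ> b) (h \<circ> d)) t) \<in> \<delta>"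
  proof (rule assms[unfolded centralizes_def, rule_format, OF t, of "h \<circ> a" _ "h \<circ> c"])
    show "(eval Q (case_sum (h \<circ> a) (h \<circ> c)) t, eval Q (case_sum (h \<circ> a) (h \<circ> d)) t) \<in> \<delta>"
      using ac car ev by (simp add: pull_def)
  qed (use ab cd in \<open>auto simp: pull_def\<close>)
  then show "(eval A (case_sum b c) t, eval A (case_sum b d) t) \<in> pull h A \<delta>"
    using car ev by (simp add: pull_def Nabla_def)
qed

text \<open>Valuations in the quotient lift to valuations related by \<alpha> and \<beta>. As
  \<delta> contains the kernel, its rows can be tested in \<open>A\<close>.\<close>

lemma centralizes_push:
  assumes \<alpha>: "\<alpha> \<in> CA" and \<beta>: "\<beta> \<in> CA" and \<delta>: "\<delta> \<in> CA" "\<theta> \<subseteq> \<delta>" and C: "centralizes ar A \<alpha> \<beta> \<delta>"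
  shows "centralizes ar Q (push h \<alpha>) (push h \<beta>) (push h \<delta>)"
  unfolding centralizes_def
proof (intro allI impI)
  fix t :: "('f, nat + nat) term" and a b c d
  assume t: "wf_term ar t" and "\<forall>i. (a i, b i) \<in> push h \<alpha>" and "\<forall>j. (c j, d j) \<in> push h \<beta>"
    and ac: "(eval Q (case_sum a c) t, eval Q (case_sum a d) t) \<in> push h \<delta>"
  then have "\<forall>i. \<exists>x y. (x, y) \<in> \<alpha> \<and> a i = h x \<and> b i = h y"
    "\<forall>j. \<exists>x y. (x, y) \<in> \<beta> \<and> c j = h x \<and> d j = h y" by (force simp: push_def)+
  then obtain a' b' c' d' where ab: "\<And>i. (a' i, b' i) \<in> \<alpha>" "\<And>i. a i = h (a' i)" "\<And>i. b i = h (b' i)"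
    and cd: "\<And>j. (c' j, d' j) \<in> \<beta>" "\<And>j. c j = h (c' j)" "\<And>j. d j = h (d' j)" by metis
  have eqs: "a = h \<circ> a'" "b = h \<circ> b'" "c = h \<circ> c'" "d = h \<circ> d'" using ab cd by auto
  note ev = eval_sum_Q[OF t]
  have car: "range a' \<subseteq> carrier A" "range b' \<subseteq> carrier A" "range c' \<subseteq> carrier A" "range d' \<subseteq> carrier A"
    using ab(1) cd(1) Con_carrier[OF \<alpha>] Con_carrier[OF \<beta>] by blast+
  have "(eval A (case_sum a' c') t, eval A (case_sum a' d') t) \<in> pull h A (push h \<delta>)"
    using ac ev car unfolding eqs by (simp add: pull_def Nabla_def)
  then have "(eval A (case_sum a' c') t, eval A (case_sum a' d') t) \<in> \<delta>"
    using pull_push_Q[OF \<delta>] by simp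
  then have "(eval A (case_sum b' c') t, eval A (case_sum b' d') t) \<in> \<delta>"
    using C t ab(1) cd(1) unfolding centralizes_def by blast
  then show "(eval Q (case_sum b c) t, eval Q (case_sum b d) t) \<in> push h \<delta>"
    unfolding eqs using ev car by (force simp: push_def)
qed

text \<open>The commutator of two preimages lies below the preimage of the commutator, so primality
  of \<phi> can be applied in \<open>A\<close>.\<close>

lemma prime_push:
  assumes p: "prime_con ar A \<phi>" and above: "\<theta> \<subseteq> \<phi>"
  shows "prime_con ar Q (push h \<phi>)"
proof -
  have \<phi>: "\<phi> \<in> CA" "\<phi> \<noteq> Nabla A" using p by (auto simp: prime_con_def)
  note push = push_Con_Q[OF \<phi>(1) above] pull_push_Q[OF \<phi>(1) above]
  have "push h \<phi> \<noteq> Nabla Q" using push(2) \<phi>(2) pull_Nabla by metis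
  moreover have "\<alpha> \<subseteq> push h \<phi> \<or> \<beta> \<subseteq> push h \<phi>"
    if \<alpha>: "\<alpha> \<in> Con ar Q" and \<beta>: "\<beta> \<in> Con ar Q" and le: "comm ar Q \<alpha> \<beta> \<subseteq> push h \<phi>" for \<alpha> \<beta>
  proof -
    note comm = comm_Con[OF alg_Q, of \<alpha> \<beta>]
    have "comm ar A (pull h A \<alpha>) (pull h A \<beta>) \<subseteq> pull h A (comm ar Q \<alpha> \<beta>)"
      by (intro comm_least pull_Con[OF alg h] comm centralizes_pull centralizes_comm alg_Q \<alpha> \<beta>)
    also have "\<dots> \<subseteq> \<phi>" using le pull_subset_iff[OF comm \<phi>(1) above] by simp
    finally have "pull h A \<alpha> \<subseteq> \<phi> \<or> pull h A \<beta> \<subseteq> \<phi>"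
      by (rule prime_comm[OF p pull_Con[OF alg h \<alpha>] pull_Con[OF alg h \<beta>]])
    then show ?thesis using pull_subset_iff[OF _ \<phi>(1) above] \<alpha> \<beta> by simp
  qed
  ultimately show ?thesis using push(1) by (simp add: prime_con_def)
qed

text \<open>The congruences \<alpha> and \<beta> must first be enlarged by \<theta>, which
  centralizes everything modulo a congruence above it. Joins are allowed in the first argument only,
  so the enlargement of \<beta> is done between two applications of symmetry, the second using that
  \<alpha> is proper.\<close>

lemma prime_pull:
  assumes p: "prime_con ar Q \<phi>"
  shows "prime_con ar A (pull h A \<phi>)"
proof -
  have \<phi>: "\<phi> \<in> Con ar Q" "\<phi> \<noteq> Nabla Q" using p by (auto simp: prime_con_def)
  note pull = pull_Con[OF alg h \<phi>(1)] and above = pull_above[OF \<phi>(1)]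
  show ?thesis
  proof (rule primeI[OF pull])
    show "pull h A \<phi> \<noteq> Nabla A" using pull_inject[OF \<phi>(1) Con_Nabla[OF alg_Q]] \<phi>(2) pull_Nabla by auto
    fix \<alpha> \<beta>
    assume \<alpha>: "\<alpha> \<in> CA" "\<alpha> \<noteq> Nabla A" and \<beta>: "\<beta> \<in> CA" "\<beta> \<noteq> Nabla A"
      and C: "centralizes ar A \<alpha> \<beta> (pull h A \<phi>)"
    let ?a = "join ar A \<alpha> \<theta>" and ?b = "join ar A \<beta> \<theta>"
    note J = join_Con[OF alg]
    have "centralizes ar A ?b \<alpha> (pull h A \<phi>)"
      by (intro centralizes_join alg centralizes_sym[OF \<alpha>(1) \<beta> pull C]
          centralizes_subset \<alpha>(1) \<beta>(1) \<theta> pull above)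
    then have "centralizes ar A \<alpha> ?b (pull h A \<phi>)" by (rule centralizes_sym[OF J \<alpha> pull])
    then have "centralizes ar A ?a ?b (pull h A \<phi>)"
      using centralizes_join[OF alg \<alpha>(1) \<theta> J _ centralizes_subset[OF \<theta> J pull above]] by blast
    from centralizes_push[OF J J pull above this]
    have "comm ar Q (push h ?a) (push h ?b) \<subseteq> \<phi>"
      using push_pull_Q[OF \<phi>(1)] by (intro comm_least \<phi>) simp
    moreover have *: "\<theta> \<subseteq> ?a" "\<theta> \<subseteq> ?b" using join_upper2[OF _ \<theta>] \<alpha>(1) \<beta>(1) by auto
    ultimately have "push h ?a \<subseteq> \<phi> \<or> push h ?b \<subseteq> \<phi>"
      by (intro prime_comm[OF p]) (auto intro!: push_Con_Q J)
    then have "?a \<subseteq> pull h A \<phi> \<or> ?b \<subseteq> pull h A \<phi>"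
      using push_subset_iff[OF \<phi>(1) J] * by blast
    then show "\<alpha> \<subseteq> pull h A \<phi> \<or> \<beta> \<subseteq> pull h A \<phi>"
      using join_upper1[OF \<alpha>(1) \<theta>] join_upper1[OF \<beta>(1) \<theta>] by blast
  qed
qed

end

section \<open>CBLP in terms of complements over a congruence of \<open>A\<close>\<close>

lemma surhom_quot:
  assumes \<theta>: "\<theta> \<in> CA"
  shows "surhom ar (\<lambda>x. \<theta> `` {x}) A (quot A \<theta>)"
proof -
  have eq: "equiv (carrier A) \<theta>" using \<theta> by (simp add: Con_def)
  have "\<theta> `` {ops A f (map (\<lambda>X. SOME x. x \<in> X) (map (\<lambda>x. \<theta> `` {x}) xs))} = \<theta> `` {ops A f xs}"
    if len: "length xs = ar f" and xs: "set xs \<subseteq> carrier A" for f xs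
  proof (rule equiv_class_eq[OF eq], rule Con_ops[OF \<theta>])
    have "(SOME y. y \<in> \<theta> `` {x}, x) \<in> \<theta>" if "x \<in> carrier A" for x
    proof -
      have "(SOME y. y \<in> \<theta> `` {x}) \<in> \<theta> `` {x}"
        by (rule someI[of _ x]) (use Con_refl[OF \<theta> that] in simp)
      then show ?thesis using Con_sym[OF \<theta>] by blast
    qed
    then show "list_all2 (\<lambda>x y. (x, y) \<in> \<theta>) (map (\<lambda>X. SOME x. x \<in> X) (map (\<lambda>x. \<theta> `` {x}) xs)) xs"
      using xs by (auto simp: list_all2_conv_all_nth subset_iff)
  qed (use len in simp)
  then show ?thesis by (auto simp: surhom_def quot_def quotient_def comp_def)
qed

lemma ker_quot:
  assumes \<theta>: "\<theta> \<in> CA"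
  shows "pull (\<lambda>x. \<theta> `` {x}) A Id = \<theta>"
proof -
  have "equiv (carrier A) \<theta>" using \<theta> by (simp add: Con_def)
  then show ?thesis
    using eq_equiv_class_iff[of "carrier A" \<theta>] Con_subset[OF \<theta>]
    by (auto simp: pull_def Nabla_def)
qed

lemma quot_con_push: "quot_con \<theta> \<chi> = push (\<lambda>x. \<theta> `` {x}) \<chi>"
  by (force simp: quot_con_def push_def)

text \<open>By correspondence, lifting is expressed inside the congruence lattice of
  \<open>A\<close>, where the conditions for \<theta> and for its radical can be compared.\<close>

lemma CBLP_iff:
  assumes \<theta>: "\<theta> \<in> CA"
  shows "CBLP ar A \<theta> \<longleftrightarrow> (\<forall>\<chi>\<in>CA. \<forall>\<chi>'\<in>CA. \<chi> \<inter> \<chi>' = \<theta> \<longrightarrow> join ar A \<chi> \<chi>' = Nabla A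
     \<longrightarrow> (\<exists>\<alpha>\<in>BoolCon ar A. join ar A \<alpha> \<theta> = \<chi>))"
proof -
  let ?h = "\<lambda>x. \<theta> `` {x}" and ?Q = "quot A \<theta>"
  note Q = \<theta> surhom_quot[OF \<theta>] ker_quot[OF \<theta>]
  have \<alpha>\<theta>: "join ar A \<alpha> \<theta> \<in> CA" "\<theta> \<subseteq> join ar A \<alpha> \<theta>" if "\<alpha> \<in> BoolCon ar A" for \<alpha>
    using that join_Con[OF alg] join_upper2[OF _ \<theta>] by (auto simp: BoolCon_def)
  show ?thesis
  proof (intro iffI ballI impI)
    fix \<chi> \<chi>'
    assume "CBLP ar A \<theta>" and \<chi>: "\<chi> \<in> CA" "\<chi>' \<in> CA" "\<chi> \<inter> \<chi>' = \<theta>" "join ar A \<chi> \<chi>' = Nabla A"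
    have above: "\<theta> \<subseteq> \<chi>" using \<chi>(3) by blast
    note push = push_Con_Q[OF Q \<chi>(1) above] pull_push_Q[OF Q \<chi>(1) above]
    have "push ?h \<chi> \<in> BoolCon ar ?Q" using BoolCon_Q[OF Q] push \<chi> by auto
    then obtain \<alpha> where "\<alpha> \<in> BoolCon ar A" "push ?h (join ar A \<alpha> \<theta>) = push ?h \<chi>"
      using \<open>CBLP ar A \<theta>\<close> unfolding CBLP_def quot_con_push by blast
    then show "\<exists>\<alpha>\<in>BoolCon ar A. join ar A \<alpha> \<theta> = \<chi>"
      using pull_push_Q[OF Q \<alpha>\<theta>] push(2) by metis
  next
    assume R: "\<forall>\<chi>\<in>CA. \<forall>\<chi>'\<in>CA. \<chi> \<inter> \<chi>' = \<theta> \<longrightarrow> join ar A \<chi> \<chi>' = Nabla A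
     \<longrightarrow> (\<exists>\<alpha>\<in>BoolCon ar A. join ar A \<alpha> \<theta> = \<chi>)"
    show "CBLP ar A \<theta>"
      unfolding CBLP_def quot_con_push
    proof
      fix \<beta> assume "\<beta> \<in> BoolCon ar ?Q"
      then obtain \<chi>' where \<beta>: "\<beta> \<in> Con ar ?Q"
        and "\<chi>' \<in> CA" "pull ?h A \<beta> \<inter> \<chi>' = \<theta>" "join ar A (pull ?h A \<beta>) \<chi>' = Nabla A"
        using BoolCon_Q[OF Q] by blast
      then obtain \<alpha> where "\<alpha> \<in> BoolCon ar A" "join ar A \<alpha> \<theta> = pull ?h A \<beta>"
        using R pull_Con[OF alg Q(2) \<beta>] by blast
      then show "\<exists>\<alpha>\<in>BoolCon ar A. push ?h (join ar A \<alpha> \<theta>) = \<beta>"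
        using push_pull_Q[OF Q \<beta>] by metis
    qed
  qed
qed

text \<open>Both congruences are written as joins of principal ones; compactness of \<nabla> leaves
  finitely many generators.\<close>

lemma finite_generators_of_join:
  assumes \<chi>: "\<chi> \<in> CA" and \<chi>': "\<chi>' \<in> CA" and top: "join ar A \<chi> \<chi>' = Nabla A"
  obtains E where "finite E" "E \<subseteq> \<chi> \<union> \<chi>'" "Cg ar A E = Nabla A"
proof -
  let ?S = "(\<lambda>p. Cg ar A {p}) ` (\<chi> \<union> \<chi>')"
  have sub: "\<chi> \<union> \<chi>' \<subseteq> Nabla A" using Con_subset[OF \<chi>] Con_subset[OF \<chi>'] by simp
  obtain R where "finite R" "R \<subseteq> Nabla A" "Cg ar A R = Nabla A"
    by (rule Nabla_finitely_generated)
  then have "Nabla A \<in> K ar A" using Cg_finite_compact[OF alg] by metis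
  moreover have "?S \<subseteq> CA" using Cg_Con[OF alg] by blast
  moreover have "Nabla A \<subseteq> Join ar A ?S"
  proof -
    have "p \<in> Cg ar A {p}" if "p \<in> \<chi> \<union> \<chi>'" for p
      using Cg_upper[of "{p}" A ar] that sub by blast
    then have "\<chi> \<union> \<chi>' \<subseteq> \<Union>?S" by blast
    also have "\<dots> \<subseteq> Join ar A ?S"
      unfolding Join_def using Con_subset \<open>?S \<subseteq> CA\<close> by (intro Cg_upper) blast
    finally show ?thesis
      using join_Nabla[OF \<chi> \<chi>' _ top, of "Join ar A ?S"] Cg_Con[OF alg] by (simp add: Join_def)
  qed
  ultimately obtain T where T: "T \<subseteq> ?S" "finite T" "Nabla A \<subseteq> Join ar A T"
    unfolding K_def by blast
  then obtain E where E: "E \<subseteq> \<chi> \<union> \<chi>'" "finite E" "T = (\<lambda>p. Cg ar A {p}) ` E"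
    using finite_subset_image by metis
  have "Cg ar A {p} \<subseteq> Cg ar A E" if "p \<in> E" for p
    using that Cg_upper[of E A ar] E(1) sub by (intro Cg_least Cg_Con[OF alg]) auto
  then have "Join ar A T \<subseteq> Cg ar A E"
    unfolding Join_def E(3) by (intro Cg_least Cg_Con[OF alg]) auto
  then have "Cg ar A E = Nabla A" using T(3) Con_subset[OF Cg_Con[OF alg]] by blast
  then show ?thesis using that E by blast
qed

text \<open>The complemented pair over \<open>\<rho>(\<theta>)\<close> is replaced by compact congruences of \<open>A/\<theta>\<close> whose
classes are complementary in the reticulation.\<close>

lemma complement_lifts_from_rho:
  assumes \<theta>: "\<theta> \<in> CA" and \<chi>: "\<chi> \<in> CA" and \<chi>': "\<chi>' \<in> CA"
    and bot: "\<chi> \<inter> \<chi>' = rho ar A \<theta>" and top: "join ar A \<chi> \<chi>' = Nabla A"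
  obtains \<psi> \<psi>' where "\<psi> \<in> CA" "\<psi>' \<in> CA" "\<psi> \<inter> \<psi>' = \<theta>" "join ar A \<psi> \<psi>' = Nabla A"
    "\<forall>\<phi>. prime_con ar A \<phi> \<longrightarrow> \<theta> \<subseteq> \<phi> \<longrightarrow> (\<psi> \<subseteq> \<phi> \<longleftrightarrow> \<chi> \<subseteq> \<phi>)"
proof -
  let ?h = "\<lambda>x. \<theta> `` {x}" and ?Q = "quot A \<theta>"
  note Q = \<theta> surhom_quot[OF \<theta>] ker_quot[OF \<theta>]
  note alg_Q = alg_Q[OF Q]
  have above: "\<theta> \<subseteq> \<chi>" "\<theta> \<subseteq> \<chi>'" using rho_upper[OF \<theta>] bot by blast+
  obtain E where E: "finite E" "E \<subseteq> \<chi> \<union> \<chi>'" "Cg ar A E = Nabla A"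
    by (rule finite_generators_of_join[OF \<chi> \<chi>' top])
  \<comment> \<open>The generators from \<open>E\<close> that lie in \<xi> yield a compact
    congruence of the quotient below the image of \<xi>. For \<chi> and \<open>\<chi>'\<close> these
    still join to the top.\<close>
  define \<sigma> where "\<sigma> \<xi> = Cg ar ?Q (push ?h (E \<inter> \<xi>))" for \<xi>
  have \<sigma>: "\<sigma> \<xi> \<in> K ar ?Q" "\<sigma> \<xi> \<in> Con ar ?Q" "\<sigma> \<xi> \<subseteq> push ?h \<xi>" "E \<inter> \<xi> \<subseteq> pull ?h A (\<sigma> \<xi>)"
    if \<xi>: "\<xi> \<in> CA" "\<theta> \<subseteq> \<xi>" for \<xi>
  proof -
    note push = push_Con_Q[OF Q \<xi>]
    have le: "push ?h (E \<inter> \<xi>) \<subseteq> push ?h \<xi>" by (rule push_mono) simp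
    then have N: "push ?h (E \<inter> \<xi>) \<subseteq> Nabla ?Q" using Con_subset[OF push] by blast
    show "\<sigma> \<xi> \<in> K ar ?Q" unfolding \<sigma>_def
      using E(1) by (intro Cg_finite_compact alg_Q N) (simp add: push_def)
    show "\<sigma> \<xi> \<in> Con ar ?Q" unfolding \<sigma>_def by (rule Cg_Con[OF alg_Q])
    show "\<sigma> \<xi> \<subseteq> push ?h \<xi>" unfolding \<sigma>_def by (rule Cg_least[OF push le])
    have "E \<inter> \<xi> \<subseteq> Nabla A" using Con_subset[OF \<xi>(1)] by blast
    then show "E \<inter> \<xi> \<subseteq> pull ?h A (\<sigma> \<xi>)"
      using Cg_upper[OF N, of ar] unfolding \<sigma>_def by (auto simp: pull_def push_def)
  qed
  note s = \<sigma>[OF \<chi> above(1)] and s' = \<sigma>[OF \<chi>' above(2)]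
  let ?p = "pull ?h A (\<sigma> \<chi>)" and ?p' = "pull ?h A (\<sigma> \<chi>')"
  note p = pull_Con[OF alg Q(2) s(2)] and p' = pull_Con[OF alg Q(2) s'(2)]
  have le: "?p \<subseteq> \<chi>" "?p' \<subseteq> \<chi>'"
    using pull_subset_iff[OF Q s(2) \<chi> above(1)] pull_subset_iff[OF Q s'(2) \<chi>' above(2)] s(3) s'(3)
    by simp_all
  have "E \<subseteq> join ar A ?p ?p'"
    using E(2) s(4) s'(4) join_upper1[OF p p'] join_upper2[OF p p'] by blast
  from Cg_least[OF join_Con[OF alg] this] have topA: "join ar A ?p ?p' = Nabla A"
    using E(3) Con_subset[OF join_Con[OF alg]] by blast
  \<comment> \<open>The preimage of a prime of the quotient is a prime above \<theta>. It contains
    the radical of \<theta>, hence the intersection of \<open>?p\<close> and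
    \<open>?p'\<close>.\<close>
  have comm: "comm ar ?Q (\<sigma> \<chi>) (\<sigma> \<chi>') \<subseteq> P" if P: "prime_con ar ?Q P" for P
  proof -
    have PC: "P \<in> Con ar ?Q" using P by (simp add: prime_con_def)
    have "rho ar A \<theta> \<subseteq> pull ?h A P"
      by (rule rho_subset_prime[OF prime_pull[OF Q P] pull_above[OF Q PC]])
    then have "pull ?h A (\<sigma> \<chi> \<inter> \<sigma> \<chi>') \<subseteq> pull ?h A P"
      using le bot by (auto simp: pull_Int[OF Q])
    then have "\<sigma> \<chi> \<inter> \<sigma> \<chi>' \<subseteq> P"
      using pull_subset_iff[OF Q Con_Int[OF alg_Q s(2) s'(2)] pull_Con[OF alg Q(2) PC] pull_above[OF Q PC]]
        push_pull_Q[OF Q PC] by simp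
    then show ?thesis using comm_subset_Int[OF alg_Q s(2) s'(2)] by blast
  qed
  have "rho ar ?Q (comm ar ?Q (\<sigma> \<chi>) (\<sigma> \<chi>')) = rho ar ?Q (Delta ?Q)"
  proof -
    have "{\<phi>. prime_con ar ?Q \<phi> \<and> comm ar ?Q (\<sigma> \<chi>) (\<sigma> \<chi>') \<subseteq> \<phi>} =
        {\<phi>. prime_con ar ?Q \<phi> \<and> Delta ?Q \<subseteq> \<phi>}"
      using comm Delta_subset[of _ ar ?Q] unfolding prime_con_def[of ar ?Q] by blast
    then show ?thesis by (simp add: rho_def)
  qed
  moreover have "join ar ?Q (\<sigma> \<chi>) (\<sigma> \<chi>') = Nabla ?Q"
    using pull_complement[OF Q s(2) s'(2)] topA by simp
  ultimately have "ret_bool ar ?Q (\<sigma> \<chi>)"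
    using s(1) s'(1) unfolding ret_bool_def by auto
  then obtain \<gamma> where \<gamma>: "\<gamma> \<in> BoolCon ar ?Q" and rho: "rho ar ?Q \<gamma> = rho ar ?Q (\<sigma> \<chi>)"
    using image_standing(3)[OF A_in_V Q(2)] unfolding ret_preserves_bool_def by blast
  then obtain \<psi>' where \<gamma>C: "\<gamma> \<in> Con ar ?Q" and \<psi>': "\<psi>' \<in> CA" "pull ?h A \<gamma> \<inter> \<psi>' = \<theta>"
    "join ar A (pull ?h A \<gamma>) \<psi>' = Nabla A"
    using BoolCon_Q[OF Q] by blast
  have "pull ?h A \<gamma> \<subseteq> \<phi> \<longleftrightarrow> \<chi> \<subseteq> \<phi>" if \<phi>: "prime_con ar A \<phi>" and \<phi>\<theta>: "\<theta> \<subseteq> \<phi>" for \<phi>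
  proof -
    have \<phi>C: "\<phi> \<in> CA" "\<phi> \<noteq> Nabla A" using \<phi> by (auto simp: prime_con_def)
    note P = prime_push[OF Q \<phi> \<phi>\<theta>]
    have "\<gamma> \<subseteq> push ?h \<phi> \<longleftrightarrow> \<sigma> \<chi> \<subseteq> push ?h \<phi>"
      using rho_subset_prime[OF P, of \<gamma>] rho_subset_prime[OF P, of "\<sigma> \<chi>"]
        rho_upper[OF \<gamma>C] rho_upper[OF s(2)] rho by blast
    then have "pull ?h A \<gamma> \<subseteq> \<phi> \<longleftrightarrow> ?p \<subseteq> \<phi>"
      using pull_subset_iff[OF Q \<gamma>C \<phi>C(1) \<phi>\<theta>] pull_subset_iff[OF Q s(2) \<phi>C(1) \<phi>\<theta>] by simp
    also have "?p \<subseteq> \<phi> \<longleftrightarrow> \<chi> \<subseteq> \<phi>"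
    proof
      \<comment> \<open>As \<open>?p\<close> and \<open>?p'\<close> join to \<nabla>, the prime
        cannot also contain \<open>\<chi>'\<close>, so it must contain the other factor of
        \<open>\<chi> \<inter> \<chi>'\<close>.\<close>
      assume "?p \<subseteq> \<phi>"
      then have "\<not> \<chi>' \<subseteq> \<phi>" using join_Nabla[OF p p' \<phi>C(1) topA] le(2) \<phi>C(2) by blast
      moreover have "\<chi> \<inter> \<chi>' \<subseteq> \<phi>" using rho_subset_prime[OF \<phi> \<phi>\<theta>] bot by simp
      ultimately show "\<chi> \<subseteq> \<phi>" using prime_Int[OF alg \<phi> \<chi> \<chi>'] by blast
    qed (use le in blast)
    finally show ?thesis .
  qed
  then show ?thesis using that[OF pull_Con[OF alg Q(2) \<gamma>C] \<psi>'] by blast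
qed

text \<open>Each inclusion follows one pattern: to place a congruence below another by
  \<open>subset_of_codisjoint\<close>, the larger one is joined with a complement of the smaller,
  and no prime lies above this join because the congruences in play lie below the same
  primes.\<close>

lemma CBLP_rho:
  assumes \<theta>: "\<theta> \<in> CA"
  shows "CBLP ar A \<theta> \<longleftrightarrow> CBLP ar A (rho ar A \<theta>)"
proof -
  let ?\<rho> = "rho ar A \<theta>"
  note \<rho> = rho_Con[OF alg, of \<theta>] and \<theta>\<rho> = rho_upper[OF \<theta>]
  have prime_proper: False
    if "prime_con ar A \<phi>" "\<alpha> \<in> CA" "\<beta> \<in> CA" "join ar A \<alpha> \<beta> = Nabla A" "\<alpha> \<subseteq> \<phi>" "\<beta> \<subseteq> \<phi>" for \<phi> \<alpha> \<beta>
    using that join_Nabla[of \<alpha> \<beta> \<phi>] by (auto simp: prime_con_def)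
  show ?thesis
    unfolding CBLP_iff[OF \<theta>] CBLP_iff[OF \<rho>]
  proof (intro iffI ballI impI)
    fix \<chi> \<chi>'
    assume R: "\<forall>\<chi>\<in>CA. \<forall>\<chi>'\<in>CA. \<chi> \<inter> \<chi>' = \<theta> \<longrightarrow> join ar A \<chi> \<chi>' = Nabla A
        \<longrightarrow> (\<exists>\<alpha>\<in>BoolCon ar A. join ar A \<alpha> \<theta> = \<chi>)"
      and \<chi>: "\<chi> \<in> CA" and \<chi>': "\<chi>' \<in> CA" and bot: "\<chi> \<inter> \<chi>' = ?\<rho>" and top: "join ar A \<chi> \<chi>' = Nabla A"
    obtain \<psi> \<psi>' where \<psi>: "\<psi> \<in> CA" and \<psi>': "\<psi>' \<in> CA"
      and \<psi>bot: "\<psi> \<inter> \<psi>' = \<theta>" and \<psi>top: "join ar A \<psi> \<psi>' = Nabla A"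
      and same: "\<forall>\<phi>. prime_con ar A \<phi> \<longrightarrow> \<theta> \<subseteq> \<phi> \<longrightarrow> (\<psi> \<subseteq> \<phi> \<longleftrightarrow> \<chi> \<subseteq> \<phi>)"
      by (rule complement_lifts_from_rho[OF \<theta> \<chi> \<chi>' bot top])
    obtain \<alpha> where \<alpha>: "\<alpha> \<in> BoolCon ar A" "join ar A \<alpha> \<theta> = \<psi>" using R \<psi> \<psi>' \<psi>bot \<psi>top by blast
    then have \<alpha>C: "\<alpha> \<in> CA" by (simp add: BoolCon_def)
    have le: "\<theta> \<subseteq> \<chi>" "\<theta> \<subseteq> \<psi>" "?\<rho> \<subseteq> \<chi>" using \<theta>\<rho> bot \<psi>bot by auto
    let ?J = "join ar A \<alpha> ?\<rho>"
    note J = join_Con[OF alg, of \<alpha> ?\<rho>]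
    have up: "\<alpha> \<subseteq> ?J" "?\<rho> \<subseteq> ?J" using join_upper1[OF \<alpha>C \<rho>] join_upper2[OF \<alpha>C \<rho>] by simp_all
    have \<psi>J: "\<psi> \<subseteq> ?J" unfolding \<alpha>(2)[symmetric] using up \<theta>\<rho> by (intro join_least J) auto
    \<comment> \<open>A prime above this join contains \<psi>, hence \<chi> by \<open>same\<close>,
      and also \<open>\<chi>'\<close>, which is impossible by \<open>top\<close>.\<close>
    have "join ar A ?J \<chi>' = Nabla A"
    proof (rule eq_NablaI[OF join_Con[OF alg]])
      fix \<phi> assume \<phi>: "prime_con ar A \<phi>" "join ar A ?J \<chi>' \<subseteq> \<phi>"
      then have "?J \<subseteq> \<phi>" "\<chi>' \<subseteq> \<phi>" using join_upper1[OF J \<chi>'] join_upper2[OF J \<chi>'] by auto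
      then show False using same[rule_format, OF \<phi>(1)] \<psi>J le prime_proper[OF \<phi>(1) \<chi> \<chi>' top] by blast
    qed
    then have "\<chi> \<subseteq> ?J" by (rule subset_of_codisjoint[OF J \<chi> \<chi>']) (use bot up in simp)
    moreover have "join ar A \<chi> \<psi>' = Nabla A"
    proof (rule eq_NablaI[OF join_Con[OF alg]])
      fix \<phi> assume \<phi>: "prime_con ar A \<phi>" "join ar A \<chi> \<psi>' \<subseteq> \<phi>"
      then have "\<chi> \<subseteq> \<phi>" "\<psi>' \<subseteq> \<phi>" using join_upper1[OF \<chi> \<psi>'] join_upper2[OF \<chi> \<psi>'] by auto
      then show False using same[rule_format, OF \<phi>(1)] le prime_proper[OF \<phi>(1) \<psi> \<psi>' \<psi>top] by blast
    qed
    then have "\<psi> \<subseteq> \<chi>" by (rule subset_of_codisjoint[OF \<chi> \<psi> \<psi>']) (use \<psi>bot le in simp)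
    then have "?J \<subseteq> \<chi>"
      using \<alpha>(2) join_upper1[OF \<alpha>C \<theta>] le by (intro join_least \<chi>) auto
    ultimately show "\<exists>\<alpha>\<in>BoolCon ar A. join ar A \<alpha> ?\<rho> = \<chi>" using \<alpha>(1) by blast
  next
    fix \<chi> \<chi>'
    assume R: "\<forall>\<chi>\<in>CA. \<forall>\<chi>'\<in>CA. \<chi> \<inter> \<chi>' = ?\<rho> \<longrightarrow> join ar A \<chi> \<chi>' = Nabla A
        \<longrightarrow> (\<exists>\<alpha>\<in>BoolCon ar A. join ar A \<alpha> ?\<rho> = \<chi>)"
      and \<chi>: "\<chi> \<in> CA" and \<chi>': "\<chi>' \<in> CA" and bot: "\<chi> \<inter> \<chi>' = \<theta>" and top: "join ar A \<chi> \<chi>' = Nabla A"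
    have le: "\<theta> \<subseteq> \<chi>" "\<theta> \<subseteq> \<chi>'" using bot by auto
    let ?X = "join ar A \<chi> ?\<rho>" and ?X' = "join ar A \<chi>' ?\<rho>"
    note X = join_Con[OF alg, of \<chi> ?\<rho>] and X' = join_Con[OF alg, of \<chi>' ?\<rho>]
    have up: "\<chi> \<subseteq> ?X" "\<chi>' \<subseteq> ?X'" "?\<rho> \<subseteq> ?X" "?\<rho> \<subseteq> ?X'"
      using join_upper1[OF _ \<rho>] join_upper2[OF _ \<rho>] \<chi> \<chi>' by auto
    \<comment> \<open>Every prime above \<theta> contains the radical and one of \<chi>,
      \<open>\<chi>'\<close>, so joining with the radical keeps the pair complementary over
      it.\<close>
    have "?X \<inter> ?X' \<subseteq> \<phi>" if \<phi>: "prime_con ar A \<phi>" "\<theta> \<subseteq> \<phi>" for \<phi>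
    proof -
      have \<phi>C: "\<phi> \<in> CA" using \<phi> by (simp add: prime_con_def)
      have "\<chi> \<subseteq> \<phi> \<or> \<chi>' \<subseteq> \<phi>" using prime_Int[OF alg \<phi>(1) \<chi> \<chi>'] bot \<phi>(2) by simp
      then have "?X \<subseteq> \<phi> \<or> ?X' \<subseteq> \<phi>"
        using join_least[OF \<phi>C] rho_subset_prime[OF \<phi>] by blast
      then show ?thesis by blast
    qed
    then have "?X \<inter> ?X' \<subseteq> ?\<rho>" using Con_subset[OF X] unfolding rho_def[of ar A \<theta>] by blast
    then have "?X \<inter> ?X' = ?\<rho>" using up by blast
    moreover have "join ar A ?X ?X' = Nabla A"
      using join_Nabla[OF \<chi> \<chi>' join_Con[OF alg] top] up join_upper1[OF X X'] join_upper2[OF X X']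
      by blast
    ultimately obtain \<alpha> where \<alpha>: "\<alpha> \<in> BoolCon ar A" "join ar A \<alpha> ?\<rho> = ?X" using R X X' by blast
    then obtain \<alpha>' where \<alpha>C: "\<alpha> \<in> CA" and \<alpha>': "\<alpha>' \<in> CA"
      and \<alpha>bot: "\<alpha> \<inter> \<alpha>' = Delta A" and \<alpha>top: "join ar A \<alpha> \<alpha>' = Nabla A"
      by (auto simp: BoolCon_def)
    \<comment> \<open>Both have the same join with the radical, and a prime above \<theta> contains
      the radical anyway.\<close>
    have same: "\<alpha> \<subseteq> \<phi> \<longleftrightarrow> \<chi> \<subseteq> \<phi>" if \<phi>: "prime_con ar A \<phi>" "\<theta> \<subseteq> \<phi>" for \<phi>
    proof -
      have "\<phi> \<in> CA" using \<phi> by (simp add: prime_con_def)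
      then have "join ar A \<xi> ?\<rho> \<subseteq> \<phi> \<longleftrightarrow> \<xi> \<subseteq> \<phi>" if "\<xi> \<in> CA" for \<xi>
        using join_least[of \<phi> ar A \<xi> ?\<rho>] join_upper1[OF that \<rho>] rho_subset_prime[OF \<phi>] by blast
      then show ?thesis using \<alpha>(2) \<alpha>C \<chi> by metis
    qed
    let ?J = "join ar A \<alpha> \<theta>"
    note J = join_Con[OF alg, of \<alpha> \<theta>]
    have upJ: "\<alpha> \<subseteq> ?J" "\<theta> \<subseteq> ?J" using join_upper1[OF \<alpha>C \<theta>] join_upper2[OF \<alpha>C \<theta>] by simp_all
    have "join ar A ?J \<chi>' = Nabla A"
    proof (rule eq_NablaI[OF join_Con[OF alg]])
      fix \<phi> assume \<phi>: "prime_con ar A \<phi>" "join ar A ?J \<chi>' \<subseteq> \<phi>"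
      then have "?J \<subseteq> \<phi>" "\<chi>' \<subseteq> \<phi>" using join_upper1[OF J \<chi>'] join_upper2[OF J \<chi>'] by auto
      then show False using same[OF \<phi>(1)] upJ prime_proper[OF \<phi>(1) \<chi> \<chi>' top] by blast
    qed
    then have "\<chi> \<subseteq> ?J" by (rule subset_of_codisjoint[OF J \<chi> \<chi>']) (use bot upJ in simp)
    moreover have "join ar A \<chi> \<alpha>' = Nabla A"
    proof (rule eq_NablaI[OF join_Con[OF alg]])
      fix \<phi> assume \<phi>: "prime_con ar A \<phi>" "join ar A \<chi> \<alpha>' \<subseteq> \<phi>"
      then have "\<chi> \<subseteq> \<phi>" "\<alpha>' \<subseteq> \<phi>" using join_upper1[OF \<chi> \<alpha>'] join_upper2[OF \<chi> \<alpha>'] by auto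
      then show False using same[OF \<phi>(1)] le prime_proper[OF \<phi>(1) \<alpha>C \<alpha>' \<alpha>top] by blast
    qed
    then have "\<alpha> \<subseteq> \<chi>"
      by (rule subset_of_codisjoint[OF \<chi> \<alpha>C \<alpha>']) (use \<alpha>bot Delta_subset[OF \<chi>] in simp)
    then have "?J \<subseteq> \<chi>" using le by (intro join_least \<chi>) auto
    ultimately show "\<exists>\<alpha>\<in>BoolCon ar A. join ar A \<alpha> \<theta> = \<chi>" using \<alpha>(1) by blast
  qed
qed

end

theorem theorem5p4:
  fixes ar :: "'f \<Rightarrow> nat"
    and Eqs :: "(('f, nat) term \<times> ('f, nat) term) set"
    and A :: "('a, 'f) alg"
    and \<theta> :: "('a \<times> 'a) set"
  assumes finite_sig: "finite (UNIV :: 'f set)"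
    and wf_Eqs: "\<forall>(s, t)\<in>Eqs. wf_term ar s \<and> wf_term ar t"
    and standing_a: "\<forall>B :: ('a, 'f) alg. standing ar Eqs B"
    and standing_aset: "\<forall>B :: ('a set, 'f) alg. standing ar Eqs B"
    and A_in_V: "inV ar Eqs A"
    and theta_Con: "\<theta> \<in> Con ar A"
  shows "CBLP ar A \<theta> \<longleftrightarrow> CBLP ar A (rho ar A \<theta>)"
proof -
  interpret semidegenerate_modular ar Eqs A
    by unfold_locales fact+
  show ?thesis by (rule CBLP_rho[OF theta_Con])
qed

end
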